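(* Let $n,k,t$ be integers with $k>t>0$ such that (i) $n\ge (t+1)(k+1-t)$, (ii) $n\ge t+\frac12(k+1-t)(k-t)$, and (iii) $\displaystyle \frac13\binom{n-t}{k-t}\ge \sum_{s=1}^{\min\{t,k-t\}}\binom{t-1}{s-1}\binom{k+1-t}{s}\binom{k-t+s}{s}\binom{n-t-s}{k-t-s}.$ Then $\operatorname{tw}(K(n,k,t))=\binom{n}{k}-\binom{n-t}{k-t}-1$.
   Context: For integers $k>t\ge 1$ and $n>2k-t$, the generalized Kneser graph $K(n,k,t)$ is the graph whose vertices are the $k$-element subsets of $[n]=\{1,\dots,n\}$, two vertices $K,K'$ being adjacent if and only if $|K\cap K'|<t$. A tree decomposition of a graph $\Gamma$ is a pair $(T,(B_x)_{x\in V(T)})$ where $T$ is a tree and each $B_x\subseteq V(\Gamma)$, such that every edge of $\Gamma$ is contained in some $B_x$, and for each vertex $v$ of $\Gamma$ the set $\{x\in V(T): v\in B_x\}$ is non-empty and induces a connected subgraph of $T$. Its width is $\max_x |B_x|-1$, and the treewidth $\operatorname{tw}(\Gamma)$ is the minimum width of a tree decomposition of $\Gamma$. (Condition (i) implies $n>2k-t$.) *)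

theory Defs
  imports Complex_Main
begin

text \<open>Graphs are given by a vertex set and a symmetric adjacency predicate.\<close>

definition connected_in :: "'a set \<Rightarrow> ('a \<Rightarrow> 'a \<Rightarrow> bool) \<Rightarrow> bool" where
  "connected_in S E \<longleftrightarrow>
     (\<forall>x\<in>S. \<forall>y\<in>S. (x, y) \<in> {(a, b). a \<in> S \<and> b \<in> S \<and> E a b}\<^sup>*)"

text \<open>A (finite) tree: finite nonempty simple graph, connected and without cycles.
  Tree nodes are taken from type nat (every finite tree is isomorphic to one on nat).\<close>

definition is_tree :: "nat set \<Rightarrow> (nat \<Rightarrow> nat \<Rightarrow> bool) \<Rightarrow> bool" where
  "is_tree VT ET \<longleftrightarrow>
     finite VT \<and> VT \<noteq> {} \<and>
     (\<forall>x y. ET x y \<longrightarrow> x \<in> VT \<and> y \<in> VT \<and> x \<noteq> y \<and> ET y x) \<and>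
     connected_in VT ET \<and>
     \<not> (\<exists>cs. 3 \<le> length cs \<and> distinct cs \<and> set cs \<subseteq> VT \<and>
            (\<forall>i < length cs - 1. ET (cs ! i) (cs ! (i + 1))) \<and> ET (last cs) (hd cs))"

definition tree_decomposition ::
  "'a set \<Rightarrow> ('a \<Rightarrow> 'a \<Rightarrow> bool) \<Rightarrow> nat set \<Rightarrow> (nat \<Rightarrow> nat \<Rightarrow> bool) \<Rightarrow> (nat \<Rightarrow> 'a set) \<Rightarrow> bool" where
  "tree_decomposition V E VT ET B \<longleftrightarrow>
     is_tree VT ET \<and>
     (\<forall>x\<in>VT. B x \<subseteq> V) \<and>
     (\<forall>u\<in>V. \<forall>v\<in>V. E u v \<longrightarrow> (\<exists>x\<in>VT. u \<in> B x \<and> v \<in> B x)) \<and>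
     (\<forall>v\<in>V. {x\<in>VT. v \<in> B x} \<noteq> {} \<and> connected_in {x\<in>VT. v \<in> B x} ET)"

definition td_width :: "nat set \<Rightarrow> (nat \<Rightarrow> 'a set) \<Rightarrow> nat" where
  "td_width VT B = Max ((\<lambda>x. card (B x)) ` VT) - 1"

definition treewidth :: "'a set \<Rightarrow> ('a \<Rightarrow> 'a \<Rightarrow> bool) \<Rightarrow> nat" where
  "treewidth V E = (LEAST w. \<exists>VT ET B. tree_decomposition V E VT ET B \<and> td_width VT B = w)"

text \<open>Generalized Kneser graph K(n,k,t).\<close>

definition kneser_vertices :: "nat \<Rightarrow> nat \<Rightarrow> nat set set" where
  "kneser_vertices n k = {K. K \<subseteq> {1..n} \<and> card K = k}"

definition kneser_adj :: "nat \<Rightarrow> nat set \<Rightarrow> nat set \<Rightarrow> bool" where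
  "kneser_adj t K K' \<longleftrightarrow> card (K \<inter> K') < t"

end

(* Upper bound: for the t-star I, one central bag V - I together with the bags N[v] for v in I.

   Lower bound: put N = binomial (n - t) (k - t). If every bag misses more than N vertices, then
   orienting the tree towards the heavy component at each node produces two disjoint nonadjacent
   sets P, Q with |P|, |Q| > N/3 and |P| + |Q| > N. By condition (iii), the vertices that are
   nonadjacent to both members of an edge number at most N/3; hence P and Q contain no edge
   either, and P Un Q is t-intersecting. This contradicts the Erdos-Ko-Rado bound for
   n >= (t+1)(k-t+1), for which the argument follows Ahlswede and Khachatryan: among the maximum
   t-intersecting families take a left-compressed one determined, as an up-set, by its traces on
   a shortest prefix {1..m}; replacing suitable traces E containing m by E - {m} would give a
   family that is larger, or equally large but determined by {1..m-1}, unless m = t. *)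

theory Submission
  imports Defs
begin

text \<open>The factor 1/3 in (iii) comes from balancing. At a node whose bag misses more than 3c
  vertices, take a smallest union of components of the remaining forest carrying more than c of
  them. Either more than c lie outside it, which already gives the pair, or it carries more than 2c.
  In the latter case it cannot split into two smaller unions of at most c each, so it is one
  component and gives the direction. With c = N/3, either side is too large to consist of common
  non-neighbours of an edge.

  The intersection bound is needed down to n = (t+1)(k+1-t). If the traces in question have t + r
  elements, averaging over the prefix compares two quantities whose difference at that n is
  (k+1-t)(r-1)(t-1), hence 0 when r = 1 or t = 1. A weak inequality from maximality would leave
  these cases open; the minimality of m makes it strict.

  The s = 1 term of (iii) forces n - t >= 12(k - t), which leaves enough room beyond the prefix for
  the binomial comparisons.\<close>

section \<open>Balanced separations from tree decompositions\<close>

text \<open>A shortest walk from \<open>y\<close> to \<open>x\<close> avoiding the edge repeats no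
  vertex, since a loop could be cut out. Its length is at least 2, because x and y differ and the
  edge itself is excluded, so the edge closes it to a cycle.\<close>

lemma tree_edge_is_bridge:
  assumes tree: "is_tree VT ET" and xy: "ET x y"
  shows "(y, x) \<notin> {(a, b). ET a b \<and> {a, b} \<noteq> {x, y}}\<^sup>*"
proof
  let ?R = "{(a, b). ET a b \<and> {a, b} \<noteq> {x, y}}"
  assume "(y, x) \<in> ?R\<^sup>*"
  then have ex: "\<exists>p. (y, x) \<in> ?R ^^ p"
    by (simp add: rtrancl_power)
  define p where "p = (LEAST p. (y, x) \<in> ?R ^^ p)"
  have p: "(y, x) \<in> ?R ^^ p"
    unfolding p_def using ex by (rule LeastI_ex)
  have p_min: "p \<le> q" if "(y, x) \<in> ?R ^^ q" for q
    unfolding p_def using that by (rule Least_le)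
  have props: "\<And>a b. ET a b \<Longrightarrow> a \<in> VT \<and> b \<in> VT \<and> a \<noteq> b \<and> ET b a"
    using tree unfolding is_tree_def by blast
  obtain f where f: "f 0 = y" "f p = x" "\<And>i. i < p \<Longrightarrow> (f i, f (Suc i)) \<in> ?R"
    using p unfolding relpow_fun_conv by blast
  have walk: "(f i, f (i + l)) \<in> ?R ^^ l" if "i + l \<le> p" for i l
    unfolding relpow_fun_conv using that f(3) by (intro exI[of _ "\<lambda>j. f (i + j)"]) auto
  have neq: "f i \<noteq> f j" if "i < j" "j \<le> p" for i j
  proof
    assume eq: "f i = f j"
    have "(y, f i) \<in> ?R ^^ i" "(f j, x) \<in> ?R ^^ (p - j)"
      using walk[of 0 i] walk[of j "p - j"] f that by simp_all
    then have "(y, x) \<in> ?R ^^ (i + (p - j))"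
      unfolding relpow_add eq by blast
    from p_min[OF this] that show False by simp
  qed
  have "p \<noteq> 0" "p \<noteq> 1"
    using f(1,2) f(3)[of 0] props[OF xy] by (auto intro!: Nat.gr0I)
  then have p2: "2 \<le> p" by simp
  define cs where "cs = map f [0..<Suc p]"
  have nth: "cs ! i = f i" if "i \<le> p" for i
    using that unfolding cs_def by (simp del: upt_Suc)
  have "distinct cs"
    unfolding cs_def distinct_map
    by (auto simp: inj_on_def simp del: upt_Suc) (metis neq less_Suc_eq_le linorder_neqE_nat)
  moreover have edge: "ET (cs ! i) (cs ! (i + 1))" if "i < length cs - 1" for i
    using that f(3)[of i] nth[of i] nth[of "i + 1"] unfolding cs_def by simp
  moreover have "ET (last cs) (hd cs)"
    using nth[of 0] nth[of p] f xy by (simp add: cs_def hd_conv_nth last_conv_nth del: upt_Suc)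
  moreover have "set cs \<subseteq> VT"
  proof -
    have "f i \<in> VT" if "i \<le> p" for i
      using that f(2) props[OF xy] props[of "f i" "f (Suc i)"] f(3)[of i] by (cases "i = p") auto
    then show ?thesis unfolding cs_def by auto
  qed
  moreover have "3 \<le> length cs"
    using p2 unfolding cs_def by simp
  ultimately show False
    using tree unfolding is_tree_def by blast
qed

text \<open>When every node points into one of its branches, some edge is pointed along from both
  ends, and the two branches are disjoint. Each carries more than 2c vertices, so they form the
  required pair.\<close>

lemma tree_decomposition_separation:
  fixes c :: real
  assumes fin: "finite V" and td: "tree_decomposition V E VT ET B"
    and c0: "0 \<le> c" and small: "\<And>x. x \<in> VT \<Longrightarrow> 3 * c < card (V - B x)"
  obtains P Q where "P \<subseteq> V" "Q \<subseteq> V" "P \<inter> Q = {}" "\<And>u v. u \<in> P \<Longrightarrow> v \<in> Q \<Longrightarrow> \<not> E u v"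
    "c < card P" "c < card Q" "3 * c < card P + card Q"
proof (rule ccontr)
  assume no: "\<not> thesis"
  note concl = that
  have tree: "is_tree VT ET"
    and cover: "\<And>u v. u \<in> V \<Longrightarrow> v \<in> V \<Longrightarrow> E u v \<Longrightarrow> \<exists>x\<in>VT. u \<in> B x \<and> v \<in> B x"
    and T_ne: "\<And>v. v \<in> V \<Longrightarrow> {x\<in>VT. v \<in> B x} \<noteq> {}"
    and T_conn: "\<And>v. v \<in> V \<Longrightarrow> connected_in {x\<in>VT. v \<in> B x} ET"
    using td unfolding tree_decomposition_def by blast+
  have finT: "finite VT" and VTne: "VT \<noteq> {}" and conn: "connected_in VT ET"
    and props: "\<And>a b. ET a b \<Longrightarrow> a \<in> VT \<and> b \<in> VT \<and> a \<noteq> b \<and> ET b a"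
    using tree unfolding is_tree_def by blast+
  \<comment> \<open>A vertex counts for \<open>U\<close> when its whole subtree lies in
    \<open>U\<close>. Disjoint node sets then give disjoint vertex sets without edges across, since
    an edge needs a common bag.\<close>
  define A where "A U = {v \<in> V. {x\<in>VT. v \<in> B x} \<subseteq> U}" for U
  have finA: "finite (A U)" for U
    using fin unfolding A_def by simp
  have A_sep: "A U \<inter> A W = {}" "\<And>u v. u \<in> A U \<Longrightarrow> v \<in> A W \<Longrightarrow> \<not> E u v" if "U \<inter> W = {}" for U W
    using that T_ne cover unfolding A_def by blast+
  have no_pair: "card (A U) \<le> c \<or> card (A W) \<le> c \<or> card (A U) + card (A W) \<le> 3 * c"
    if "U \<inter> W = {}" for U W
  proof (rule ccontr)
    assume "\<not> ?thesis"
    then have "c < card (A U)" "c < card (A W)" "3 * c < card (A U) + card (A W)"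
      by simp_all
    moreover have "A U \<subseteq> V" "A W \<subseteq> V" unfolding A_def by blast+
    ultimately show False
      using no concl[of "A U" "A W"] A_sep[OF that] by blast
  qed
  \<comment> \<open>\<open>U\<close> is a union of components of the tree with \<open>x\<close>
    removed; \<open>R x\<close> is adjacency in that forest.\<close>
  define closed where "closed x U \<longleftrightarrow> U \<subseteq> VT - {x} \<and> (\<forall>a\<in>U. \<forall>b\<in>VT - {x}. ET a b \<longrightarrow> b \<in> U)" for x U
  define R where "R x = {(a, b). a \<in> VT - {x} \<and> b \<in> VT - {x} \<and> ET a b}" for x
  have closed_walk: "b \<in> U" if "closed x U" "(a, b) \<in> (R x)\<^sup>*" "a \<in> U" for x U a b
    using that(2,1,3) by (induction rule: rtrancl_induct) (auto simp: closed_def R_def)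
  \<comment> \<open>The subtree of a vertex outside \<open>B x\<close> is connected and avoids
    \<open>x\<close>, so it cannot straddle \<open>U\<close> and the rest of the forest.\<close>
  have A_split: "A U \<union> A (VT - {x} - U) = V - B x" if "closed x U" "x \<in> VT" for x U
  proof (intro equalityI subsetI)
    fix v assume "v \<in> A U \<union> A (VT - {x} - U)"
    then show "v \<in> V - B x"
      using that unfolding A_def closed_def by auto
  next
    fix v assume v: "v \<in> V - B x"
    have "b \<in> U" if b: "b \<in> VT" "v \<in> B b" and a: "a \<in> VT" "v \<in> B a" "a \<in> U" for a b
    proof -
      have "(a, b) \<in> {(a, b). a \<in> {x\<in>VT. v \<in> B x} \<and> b \<in> {x\<in>VT. v \<in> B x} \<and> ET a b}\<^sup>*"
        using T_conn[of v] v a b unfolding connected_in_def by blast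
      also have "\<dots> \<subseteq> (R x)\<^sup>*"
        using v by (intro rtrancl_mono) (auto simp: R_def)
      finally show ?thesis using closed_walk \<open>closed x U\<close> a(3) by blast
    qed
    then show "v \<in> A U \<union> A (VT - {x} - U)"
      using v unfolding A_def by blast
  qed
  have big: "\<exists>U. closed x U \<and> (\<forall>a\<in>U. \<forall>b\<in>U. (a, b) \<in> (R x)\<^sup>*) \<and> 2 * c < card (A U)"
    if x: "x \<in> VT" for x
  proof -
    define ok where "ok U \<longleftrightarrow> closed x U \<and> c < card (A U)" for U
    have "ok (VT - {x})"
    proof -
      have cl: "closed x (VT - {x})" unfolding closed_def by blast
      have "A {} = {}" using T_ne unfolding A_def by blast
      with A_split[OF cl x] have "A (VT - {x}) = V - B x" by simp
      with small[OF x] c0 cl show ?thesis unfolding ok_def by simp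
    qed
    \<comment> \<open>Fewest nodes: if \<open>U\<close> split into two closed parts, each would
      carry at most \<open>c\<close>, against the bound 2c obtained below.\<close>
    then obtain U where U: "ok U" and U_min: "\<And>W. ok W \<Longrightarrow> card U \<le> card W"
      using ex_has_least_nat[of ok "VT - {x}" card] by blast
    have clU: "closed x U" and cU: "c < card (A U)"
      using U unfolding ok_def by auto
    have finU: "finite U" using clU finT unfolding closed_def by (meson finite_Diff finite_subset)
    have card_sum: "card (A U) + card (A (VT - {x} - U)) = card (V - B x)"
      unfolding A_split[OF clU x, symmetric] using A_sep(1)[of U "VT - {x} - U"] finA
      by (subst card_Un_disjoint) auto
    then have "real (card (A U)) + real (card (A (VT - {x} - U))) = real (card (V - B x))"
      by linarith
    then have big: "2 * c < card (A U)"
      using no_pair[of U "VT - {x} - U"] cU small[OF x] by force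
    have "(a, b) \<in> (R x)\<^sup>*" if a: "a \<in> U" and b: "b \<in> U" for a b
    proof (rule ccontr)
      assume nab: "(a, b) \<notin> (R x)\<^sup>*"
      define C where "C = (R x)\<^sup>* `` {a}"
      have CU: "C \<subseteq> U" using closed_walk[OF clU _ a] unfolding C_def by blast
      have "b \<notin> C" "a \<in> C" using nab unfolding C_def by auto
      have clC: "closed x C"
        using CU clU unfolding closed_def C_def
        by (auto simp: R_def intro: rtrancl.rtrancl_into_rtrancl)
      have clUC: "closed x (U - C)"
      proof -
        have "p \<in> C" if "q \<in> C" "p \<in> U" "ET p q" for p q
          using that CU clU props[of p q] unfolding closed_def C_def
          by (auto simp: R_def intro!: rtrancl.rtrancl_into_rtrancl[of a q _ p] )
        then show ?thesis using clU unfolding closed_def by blast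
      qed
      have "card C < card U" "card (U - C) < card U"
        using \<open>b \<notin> C\<close> b a \<open>a \<in> C\<close> CU finU by (auto intro!: psubset_card_mono)
      then have "card (A C) \<le> c" "card (A (U - C)) \<le> c"
        using U_min clC clUC unfolding ok_def by (meson not_le)+
      moreover have "A U \<subseteq> A C \<union> A (U - C)"
      proof
        fix v assume v: "v \<in> A U"
        then have "v \<in> V - B x" using A_split[OF clU x] by blast
        then have "v \<in> A C \<union> A (VT - {x} - C)" using A_split[OF clC x] by blast
        with v show "v \<in> A C \<union> A (U - C)" unfolding A_def by blast
      qed
      then have "card (A U) \<le> card (A C) + card (A (U - C))"
        by (meson card_Un_le card_mono finA finite_UnI order_trans)
      ultimately show False using big by linarith
    qed
    with clU big show ?thesis by blast
  qed
  then obtain U where U: "\<And>x. x \<in> VT \<Longrightarrow> closed x (U x)"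
      "\<And>x a b. x \<in> VT \<Longrightarrow> a \<in> U x \<Longrightarrow> b \<in> U x \<Longrightarrow> (a, b) \<in> (R x)\<^sup>*"
      "\<And>x. x \<in> VT \<Longrightarrow> 2 * c < card (A (U x))"
    by metis
  have exit: "\<exists>y\<in>U x. ET x y" if x: "x \<in> VT" for x
  proof -
    have "A {} = {}" using T_ne unfolding A_def by blast
    with U(3)[OF x] c0 have "U x \<noteq> {}" by force
    then obtain a where a: "a \<in> U x" by blast
    then have "a \<in> VT" "x \<notin> U x" using U(1)[OF x] unfolding closed_def by auto
    then have "(a, x) \<in> {(a, b). a \<in> VT \<and> b \<in> VT \<and> ET a b}\<^sup>*"
      using conn x unfolding connected_in_def by blast
    then have "x \<in> U x \<or> (\<exists>y\<in>U x. ET x y)"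
      using a
    proof (induction rule: converse_rtrancl_induct)
      case (step p q)
      then show ?case using U(1)[OF x] props[of p q] unfolding closed_def by (cases "q = x") auto
    qed simp
    with \<open>x \<notin> U x\<close> show ?thesis by blast
  qed
  \<comment> \<open>If a neighbour \<open>y\<close> of \<open>x\<close> in this least branch did not
    point back at \<open>x\<close>, then \<open>U y\<close>, which misses \<open>y\<close>, would be
    a proper subset of \<open>U x\<close>.\<close>
  obtain x where x: "x \<in> VT" and x_min: "\<And>y. y \<in> VT \<Longrightarrow> card (U x) \<le> card (U y)"
    using ex_has_least_nat[of "\<lambda>x. x \<in> VT" _ "\<lambda>x. card (U x)"] VTne by blast
  obtain y where y: "y \<in> U x" and xy: "ET x y" using exit[OF x] by blast
  have yT: "y \<in> VT" using props xy by blast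
  have "x \<in> U y"
  proof (rule ccontr)
    assume nx: "x \<notin> U y"
    obtain w where w: "w \<in> U y" and yw: "ET y w" using exit[OF yT] by blast
    have "w \<in> U x"
      using y yw w nx U(1)[OF x] props[OF yw] unfolding closed_def by blast
    have "b \<in> U x" if b: "b \<in> U y" for b
    proof -
      have "(w, b) \<in> (R y)\<^sup>*" using U(2)[OF yT w b] .
      then have "b \<in> U y \<and> b \<in> U x"
      proof (induction rule: rtrancl_induct)
        case base show ?case using w \<open>w \<in> U x\<close> by simp
      next
        case (step p q)
        then have "q \<in> U y" using U(1)[OF yT] unfolding closed_def R_def by blast
        moreover have "q \<in> U x"
          using step \<open>q \<in> U y\<close> nx U(1)[OF x] unfolding closed_def R_def by blast
        ultimately show ?case by simp
      qed
      then show ?thesis by simp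
    qed
    then have "U y \<subset> U x"
      using y U(1)[OF yT] unfolding closed_def by blast
    moreover have "finite (U x)"
      using U(1)[OF x] finT unfolding closed_def by (meson finite_Diff finite_subset)
    ultimately have "card (U y) < card (U x)" by (simp add: psubset_card_mono)
    with x_min[OF yT] show False by simp
  qed
  have "U x \<inter> U y = {}"
  proof (rule ccontr)
    assume "U x \<inter> U y \<noteq> {}"
    then obtain z where z: "z \<in> U x" "z \<in> U y" by blast
    \<comment> \<open>Walks avoiding one end of the edge xy avoid the edge, so a common node
      \<open>z\<close> would connect \<open>y\<close> to \<open>x\<close> around a bridge.\<close>
    let ?S = "{(a, b). ET a b \<and> {a, b} \<noteq> {x, y}}"
    have "R x \<subseteq> ?S" "R y \<subseteq> ?S"
      by (auto simp: R_def doubleton_eq_iff simp del: insert_iff)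
    then have "(R x)\<^sup>* \<subseteq> ?S\<^sup>*" "(R y)\<^sup>* \<subseteq> ?S\<^sup>*"
      by (simp_all only: rtrancl_mono)
    moreover have "(y, z) \<in> (R x)\<^sup>*" "(z, x) \<in> (R y)\<^sup>*"
      using U(2)[OF x y z(1)] U(2)[OF yT z(2) \<open>x \<in> U y\<close>] by auto
    ultimately have "(y, x) \<in> ?S\<^sup>*"
      by (meson rtrancl_trans subsetD)
    with tree_edge_is_bridge[OF tree xy] show False by simp
  qed
  from no_pair[OF this] U(3)[OF x] U(3)[OF yT] c0 show False by linarith
qed

section \<open>Star decompositions\<close>

lemma star_is_tree:
  "is_tree {..p} (\<lambda>a b. a \<noteq> b \<and> a \<le> p \<and> b \<le> p \<and> (a = 0 \<or> b = 0))" (is "is_tree _ ?E")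
  unfolding is_tree_def
proof (intro conjI)
  show "connected_in {..p} ?E"
    unfolding connected_in_def
  proof (intro ballI)
    fix x y assume xy: "x \<in> {..p}" "y \<in> {..p}"
    let ?R = "{(a, b). a \<in> {..p} \<and> b \<in> {..p} \<and> ?E a b}"
    have "(x, 0) \<in> ?R\<^sup>*" using xy by (cases "x = 0") auto
    moreover have "(0, y) \<in> ?R\<^sup>*" using xy by (cases "y = 0") auto
    ultimately show "(x, y) \<in> ?R\<^sup>*" by (rule rtrancl_trans)
  qed
  show "\<not> (\<exists>cs. 3 \<le> length cs \<and> distinct cs \<and> set cs \<subseteq> {..p} \<and>
            (\<forall>i < length cs - 1. ?E (cs ! i) (cs ! (i + 1))) \<and> ?E (last cs) (hd cs))"
  proof
    assume "\<exists>cs. 3 \<le> length cs \<and> distinct cs \<and> set cs \<subseteq> {..p} \<and>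
            (\<forall>i < length cs - 1. ?E (cs ! i) (cs ! (i + 1))) \<and> ?E (last cs) (hd cs)"
    then obtain cs where cs: "3 \<le> length cs" "distinct cs" "?E (last cs) (hd cs)"
      and edges: "\<And>i. i < length cs - 1 \<Longrightarrow> ?E (cs ! i) (cs ! (i + 1))"
      by blast
    obtain a b c ds where abc: "cs = a # b # c # ds"
      using cs(1) by (metis Suc_le_length_iff numeral_3_eq_3)
    have "?E a b" "?E b c" using edges[of 0] edges[of 1] abc by simp_all
    \<comment> \<open>Since \<open>a\<close> and \<open>c\<close> differ, the edges at
      \<open>b\<close> force \<open>b = 0\<close>. The closing edge then needs the last vertex to be
      0 too, a repetition.\<close>
    moreover have "last (c # ds) \<noteq> b" using cs(2) abc by (metis distinct.simps(2) last_in_set list.distinct(1))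
    moreover have "a \<noteq> c" using cs(2) abc by auto
    ultimately show False using cs(2,3) abc by auto
  qed
qed auto

text \<open>Independence confines a member of \<open>I\<close> to its own leaf, and every other
  vertex is in the centre. The strict degree bound leaves room for \<open>v\<close> in its own bag,
  so the centre determines the width.\<close>

lemma star_tree_decomposition:
  fixes E :: "'a \<Rightarrow> 'a \<Rightarrow> bool"
  assumes finV: "finite V" and sym: "\<And>u v. E u v \<Longrightarrow> E v u" and I: "I \<subseteq> V"
    and indep: "\<And>u v. u \<in> I \<Longrightarrow> v \<in> I \<Longrightarrow> \<not> E u v"
    and deg: "\<And>v. v \<in> I \<Longrightarrow> card {u \<in> V. E v u} < card (V - I)" and ne: "I \<noteq> {}"
  shows "\<exists>VT ET B. tree_decomposition V E VT ET B \<and> td_width VT B = card (V - I) - 1"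
proof -
  define p where "p = card I"
  let ?E = "\<lambda>a b. a \<noteq> b \<and> a \<le> p \<and> b \<le> p \<and> (a = 0 \<or> b = (0::nat))"
  have finI: "finite I" using I finV by (rule finite_subset)
  obtain h where h: "bij_betw h {1..p} I"
    using ex_bij_betw_nat_finite_1[OF finI] unfolding p_def by blast
  define B where "B x = (if x = 0 then V - I else insert (h x) {u \<in> V. E (h x) u})" for x
  have hI: "h x \<in> I" if "x \<noteq> 0" "x \<le> p" for x
    using h that unfolding bij_betw_def by auto
  have inj: "x = y" if "h x = h y" "x \<noteq> 0" "x \<le> p" "y \<noteq> 0" "y \<le> p" for x y
    using inj_onD[OF bij_betw_imp_inj_on[OF h] that(1)] that by simp
  have surj: "\<exists>x. x \<noteq> 0 \<and> x \<le> p \<and> h x = v" if "v \<in> I" for v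
  proof -
    obtain x where "x \<in> {1..p}" "h x = v" using h \<open>v \<in> I\<close> unfolding bij_betw_def by blast
    then show ?thesis by (intro exI[of _ x]) auto
  qed
  have "tree_decomposition V E {..p} ?E B"
    unfolding tree_decomposition_def
  proof (intro conjI ballI impI)
    show "is_tree {..p} ?E" by (rule star_is_tree)
    show "B x \<subseteq> V" if "x \<in> {..p}" for x
      using hI[of x] I that unfolding B_def by auto
    show "\<exists>x\<in>{..p}. u \<in> B x \<and> v \<in> B x" if uv: "u \<in> V" "v \<in> V" "E u v" for u v
    proof (cases "u \<in> I \<or> v \<in> I")
      case True
      then obtain w x where "w = u \<or> w = v" "x \<noteq> 0" "x \<le> p" "h x = w" using surj by blast
      then show ?thesis using uv sym unfolding B_def by (intro bexI[of _ x]) auto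
    next
      case False
      then show ?thesis using uv unfolding B_def by (intro bexI[of _ 0]) auto
    qed
    fix v assume v: "v \<in> V"
    show "{x \<in> {..p}. v \<in> B x} \<noteq> {}"
    proof (cases "v \<in> I")
      case True
      then obtain x where "x \<le> p" "x \<noteq> 0" "h x = v" using surj by blast
      then have "x \<in> {x \<in> {..p}. v \<in> B x}" unfolding B_def by simp
      then show ?thesis by blast
    next
      case False
      then have "0 \<in> {x \<in> {..p}. v \<in> B x}" using v unfolding B_def by simp
      then show ?thesis by blast
    qed
    show "connected_in {x \<in> {..p}. v \<in> B x} ?E"
    proof (cases "v \<in> I")
      case True
      have "x = y" if "x \<in> {x \<in> {..p}. v \<in> B x}" "y \<in> {x \<in> {..p}. v \<in> B x}" for x y
      proof -
        have "z \<noteq> 0 \<and> h z = v" if "z \<le> p" "v \<in> B z" for z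
          using that True hI[of z] indep[of "h z" v] unfolding B_def by (auto split: if_splits)
        then show ?thesis using that inj[of x y] by auto
      qed
      then show ?thesis unfolding connected_in_def by (metis (no_types, lifting) rtrancl.rtrancl_refl)
    next
      case False
      let ?S = "{x \<in> {..p}. v \<in> B x}"
      let ?R = "{(a, b). a \<in> ?S \<and> b \<in> ?S \<and> ?E a b}"
      have 0: "0 \<in> ?S" using False v unfolding B_def by simp
      have "(x, 0) \<in> ?R\<^sup>*" "(0, x) \<in> ?R\<^sup>*" if "x \<in> ?S" for x
        using that 0 by (cases "x = 0"; auto)+
      then show ?thesis unfolding connected_in_def by (meson rtrancl_trans)
    qed
  qed
  moreover have "td_width {..p} B = card (V - I) - 1"
  proof -
    have "Max ((\<lambda>x. card (B x)) ` {..p}) = card (V - I)"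
    proof (rule Max_eqI)
      show "card (V - I) \<in> (\<lambda>x. card (B x)) ` {..p}"
        unfolding B_def by (intro image_eqI[of _ _ 0]) auto
      fix c assume "c \<in> (\<lambda>x. card (B x)) ` {..p}"
      then obtain x where x: "x \<le> p" "c = card (B x)" by auto
      show "c \<le> card (V - I)"
      proof (cases "x = 0")
        case True
        then show ?thesis using x unfolding B_def by simp
      next
        case False
        have "card (B x) \<le> Suc (card {u \<in> V. E (h x) u})"
          using False unfolding B_def by (simp add: card_insert_le_m1 card_insert_if finV)
        also have "\<dots> \<le> card (V - I)" using deg[OF hI[OF False x(1)]] by simp
        finally show ?thesis using x(2) by simp
      qed
    qed simp
    then show ?thesis unfolding td_width_def by simp
  qed
  ultimately show ?thesis by blast
qed

section \<open>Common non-neighbours of an edge\<close>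

lemma card_fixed_trace:
  assumes S: "finite S" and E: "E \<subseteq> S \<inter> M" and k: "card E \<le> k"
  shows "card {F. F \<subseteq> S \<and> card F = k \<and> F \<inter> M = E} = (card (S - M) choose (k - card E))"
proof -
  have finE: "finite E" using S E by (meson finite_Int finite_subset)
  have "{F. F \<subseteq> S \<and> card F = k \<and> F \<inter> M = E} =
        (\<union>) E ` {X. X \<subseteq> S - M \<and> card X = k - card E}" (is "?L = _ ` ?X")
  proof (intro equalityI subsetI)
    fix F assume F: "F \<in> ?L"
    then have "card (F - E) = k - card E"
      using finE by (auto intro!: card_Diff_subset)
    moreover have "F = E \<union> (F - E)" "F - E \<subseteq> S - M" using F by auto
    ultimately show "F \<in> (\<union>) E ` ?X" by blast
  next
    fix F assume "F \<in> (\<union>) E ` ?X"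
    then obtain X where X: "F = E \<union> X" "X \<subseteq> S - M" "card X = k - card E" by blast
    then have "finite X" "E \<inter> X = {}"
      using E S by (auto intro: finite_subset[of X "S - M"])
    then have "card F = card E + card X"
      using X(1) finE card_Un_disjoint by blast
    then show "F \<in> ?L" using X E k by auto
  qed
  moreover have "inj_on ((\<union>) E) ?X"
    using E by (intro inj_onI) blast
  ultimately show ?thesis
    using n_subsets[of "S - M" "k - card E"] S by (simp add: card_image)
qed

lemma card_supersets:
  assumes "finite S" "X \<subseteq> S" "card X \<le> k"
  shows "card {F. F \<subseteq> S \<and> card F = k \<and> X \<subseteq> F} = (card S - card X choose (k - card X))"
proof -
  have "{F. F \<subseteq> S \<and> card F = k \<and> X \<subseteq> F} = {F. F \<subseteq> S \<and> card F = k \<and> F \<inter> X = X}"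
    by blast
  then show ?thesis
    using card_fixed_trace[of S X X k] assms
    by (simp add: card_Diff_subset finite_subset)
qed

lemma finite_kneser_vertices [simp]: "finite (kneser_vertices n k)"
  unfolding kneser_vertices_def by (rule finite_subset[of _ "Pow {1..n}"]) auto

lemma card_kneser_vertices: "card (kneser_vertices n k) = (n choose k)"
  using n_subsets[of "{1..n}" k] unfolding kneser_vertices_def by simp

lemma kneser_verticesD:
  assumes "F \<in> kneser_vertices n k"
  shows "F \<subseteq> {1..n}" "card F = k" "finite F"
  using assms finite_subset[of F "{1..n}"] unfolding kneser_vertices_def by auto

lemma card_UN_le_mult:
  assumes "finite I" "card I \<le> a" "\<And>i. i \<in> I \<Longrightarrow> card (A i) \<le> b"
  shows "card (\<Union>i\<in>I. A i) \<le> a * b"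
proof -
  have "card (\<Union>i\<in>I. A i) \<le> (\<Sum>i\<in>I. card (A i))"
    using assms(1) by (rule card_UN_le)
  also have "\<dots> \<le> card I * b"
    using sum_bounded_above[of I "\<lambda>i. card (A i)" b] assms(3) by simp
  also have "\<dots> \<le> a * b" using assms(2) by simp
  finally show ?thesis .
qed

text \<open>An inequality, so that \<open>X\<close> may stick out of \<open>{1..n}\<close> or have
  more than \<open>k\<close> elements; the family is then empty.\<close>

lemma card_kneser_supersets_le:
  assumes "card X = i"
  shows "card {F \<in> kneser_vertices n k. X \<subseteq> F} \<le> (n - i choose (k - i))"
proof (cases "X \<subseteq> {1..n} \<and> i \<le> k")
  case True
  then show ?thesis
    using card_supersets[of "{1..n}" X k] assms unfolding kneser_vertices_def
    by (simp add: conj_assoc)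
next
  case False
  then have empty: "{F \<in> kneser_vertices n k. X \<subseteq> F} = {}"
    using assms kneser_verticesD[of _ n k] card_mono[of _ X] by fastforce
  show ?thesis unfolding empty by simp
qed

text \<open>A set \<open>B\<close> meeting both \<open>A\<^sub>1\<close> and \<open>A\<^sub>2\<close> is classified by \<open>Q = B \<inter> P\<close>, where
  \<open>A\<^sub>1 \<inter> A\<^sub>2 \<subseteq> P \<subseteq> A\<^sub>1\<close> and \<open>card P = t - 1\<close>. If \<open>card Q = t - s\<close>, then \<open>B\<close> contains
  \<open>s\<close> elements of \<open>A\<^sub>1 - P\<close> and also \<open>s\<close> elements of any fixed
  \<open>W \<subseteq> A\<^sub>2 - Q\<close> with \<open>card W = k - t + s\<close>, because \<open>B\<close> misses at most \<open>k - t\<close> elements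
  of \<open>A\<^sub>2\<close>.\<close>

lemma card_common_nonneighbours_le:
  assumes t: "0 < t" "t \<le> k"
    and A1: "A1 \<in> kneser_vertices n k" and A2: "A2 \<in> kneser_vertices n k"
    and far: "card (A1 \<inter> A2) < t"
  shows "card {B \<in> kneser_vertices n k. t \<le> card (B \<inter> A1) \<and> t \<le> card (B \<inter> A2)}
    \<le> (\<Sum>s = 1..min t (k - t). (t - 1 choose (s - 1)) * (k + 1 - t choose s)
              * (k - t + s choose s) * (n - t - s choose (k - t - s)))"
    (is "card ?L \<le> (\<Sum>s = 1..?m. ?a s * ?b s * ?c s * ?d s)")
proof -
  note A1 = kneser_verticesD[OF A1] and A2 = kneser_verticesD[OF A2]
  obtain P where P: "A1 \<inter> A2 \<subseteq> P" "P \<subseteq> A1" "card P = t - 1"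
  proof -
    have "\<exists>P. A1 \<inter> A2 \<subseteq> P \<and> P \<subseteq> A1 \<and> card P = t - 1"
      using far t A1 by (intro exists_subset_between) auto
    then show ?thesis using that by blast
  qed
  have finP: "finite P" using P(2) A1(3) by (rule finite_subset)
  have "\<exists>W. W \<subseteq> A2 - Q \<and> card W = k - t + s" if "Q \<subseteq> P" "card Q = t - s" "s \<le> t" for Q s
  proof -
    have "finite Q" using that finP by (blast intro: finite_subset)
    then have "k - t + s \<le> card (A2 - Q)"
      using diff_card_le_card_Diff[of Q A2] that t A2 by simp
    then show ?thesis by (meson obtain_subset_with_card_n)
  qed
  then obtain W where W: "\<And>Q s. Q \<subseteq> P \<Longrightarrow> card Q = t - s \<Longrightarrow> s \<le> t \<Longrightarrow>
      W Q s \<subseteq> A2 - Q \<and> card (W Q s) = k - t + s"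
    by metis
  define Qs where "Qs s = {Q. Q \<subseteq> P \<and> card Q = t - s}" for s
  define Rs where "Rs s = {R. R \<subseteq> A1 - P \<and> card R = s}" for s
  define Ss where "Ss Q s = {S. S \<subseteq> W Q s \<and> card S = s}" for Q s
  have cover: "?L \<subseteq> (\<Union>s\<in>{1..?m}. \<Union>Q\<in>Qs s. \<Union>R\<in>Rs s. \<Union>S\<in>Ss Q s.
        {F \<in> kneser_vertices n k. Q \<union> R \<union> S \<subseteq> F})"
  proof
    fix B assume B: "B \<in> ?L"
    then have B': "B \<subseteq> {1..n}" "card B = k" "finite B"
      using kneser_verticesD[of B n k] by auto
    define s where "s = t - card (B \<inter> P)"
    have "card (B \<inter> P) \<le> t - 1" using P(3) finP by (metis card_mono inf.cobounded2)
    then have s: "1 \<le> s" "s \<le> t" "card (B \<inter> P) = t - s"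
      using t unfolding s_def by auto
    have "card (B \<inter> A1) \<le> card (B \<inter> P) + card (B \<inter> (A1 - P))"
      by (rule order_trans[OF card_mono card_Un_le]) (use B' in auto)
    then have "s \<le> card (B \<inter> (A1 - P))" using B s by auto
    then obtain R where R: "R \<subseteq> B \<inter> (A1 - P)" "card R = s"
      by (meson obtain_subset_with_card_n)
    define Q where "Q = B \<inter> P"
    have W: "W Q s \<subseteq> A2 - Q" "card (W Q s) = k - t + s"
      using W[of Q s] s unfolding Q_def by auto
    have finW: "finite (W Q s)" using W(1) A2(3) by (meson finite_Diff finite_subset)
    have "card (A2 - B) \<le> k - t"
      using B A2 by (auto simp: card_Diff_subset_Int Int_commute intro: diff_le_mono2)
    moreover have "card (W Q s) \<le> card (B \<inter> W Q s) + card (A2 - B)"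
      by (rule order_trans[OF card_mono card_Un_le]) (use B' A2 W in auto)
    ultimately have "s \<le> card (B \<inter> W Q s)" using W(2) by simp
    then obtain S where S: "S \<subseteq> B \<inter> W Q s" "card S = s"
      by (meson obtain_subset_with_card_n)
    have "card (Q \<union> R \<union> S) = t + s"
    proof -
      have "finite Q" "finite R" "finite S"
        using R S B' unfolding Q_def by (auto intro: finite_subset)
      \<comment> \<open>\<open>R\<close> avoids \<open>A2\<close> because \<open>P\<close> contains
        all of \<open>A1 \<inter> A2\<close>, whereas \<open>S\<close> lies in
        \<open>A2 - Q\<close>.\<close>
      moreover have "Q \<inter> R = {}" "(Q \<union> R) \<inter> S = {}"
        using R(1) S(1) W(1) P(1) unfolding Q_def by blast+
      ultimately show ?thesis
        using s R(2) S(2) by (simp add: card_Un_disjoint Q_def)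
    qed
    moreover have QRS: "Q \<union> R \<union> S \<subseteq> B" using R S unfolding Q_def by blast
    ultimately have "t + s \<le> k" using card_mono[OF B'(3) QRS] B' by simp
    then have "s \<in> {1..?m}" using s by simp
    moreover have "Q \<in> Qs s" using s(3) unfolding Qs_def Q_def by simp
    moreover have "R \<in> Rs s" using R unfolding Rs_def by blast
    moreover have "S \<in> Ss Q s" using S unfolding Ss_def by blast
    moreover have "B \<in> {F \<in> kneser_vertices n k. Q \<union> R \<union> S \<subseteq> F}" using QRS B by blast
    ultimately show "B \<in> (\<Union>s\<in>{1..?m}. \<Union>Q\<in>Qs s. \<Union>R\<in>Rs s. \<Union>S\<in>Ss Q s.
        {F \<in> kneser_vertices n k. Q \<union> R \<union> S \<subseteq> F})"
      by blast
  qed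
  have block: "card (\<Union>Q\<in>Qs s. \<Union>R\<in>Rs s. \<Union>S\<in>Ss Q s. {F \<in> kneser_vertices n k. Q \<union> R \<union> S \<subseteq> F})
      \<le> ?a s * (?b s * (?c s * ?d s))" if s: "s \<in> {1..?m}" for s
  proof (intro card_UN_le_mult)
    have "finite (A1 - P)" using A1(3) by simp
    then show "finite (Qs s)" "finite (Rs s)"
      using finP unfolding Qs_def Rs_def by simp_all
    have "t - 1 choose (t - s) = (t - 1 choose (s - 1))"
      using s by (subst binomial_symmetric) auto
    then show "card (Qs s) \<le> ?a s"
      unfolding Qs_def n_subsets[OF finP] P(3) by simp
    show "card (Rs s) \<le> ?b s"
      unfolding Rs_def n_subsets[OF \<open>finite (A1 - P)\<close>]
      using card_Diff_subset[OF finP P(2)] A1 P(3) t by simp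
    fix Q R assume Q: "Q \<in> Qs s" and R: "R \<in> Rs s"
    have WQ: "W Q s \<subseteq> A2 - Q" "card (W Q s) = k - t + s"
      using W[of Q s] s Q unfolding Qs_def by auto
    have finW: "finite (W Q s)" using WQ(1) A2(3) by (meson finite_Diff finite_subset)
    then show "finite (Ss Q s)" unfolding Ss_def by simp
    show "card (Ss Q s) \<le> ?c s"
      unfolding Ss_def n_subsets[OF finW] WQ(2) by simp
    fix S assume S: "S \<in> Ss Q s"
    have "card (Q \<union> R \<union> S) = t + s"
    proof -
      have "finite Q" "finite R" "finite S"
        using Q R S finP A1(3) finW unfolding Qs_def Rs_def Ss_def by (auto intro: finite_subset)
      moreover have "Q \<inter> R = {}" "(Q \<union> R) \<inter> S = {}"
        using Q R S WQ(1) P(1) unfolding Qs_def Rs_def Ss_def by blast+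
      ultimately show ?thesis
        using Q R S s unfolding Qs_def Rs_def Ss_def by (simp add: card_Un_disjoint)
    qed
    from card_kneser_supersets_le[OF this, of n k]
    show "card {F \<in> kneser_vertices n k. Q \<union> R \<union> S \<subseteq> F} \<le> ?d s" by simp
  qed
  have "card ?L \<le> card (\<Union>s\<in>{1..?m}. \<Union>Q\<in>Qs s. \<Union>R\<in>Rs s. \<Union>S\<in>Ss Q s.
        {F \<in> kneser_vertices n k. Q \<union> R \<union> S \<subseteq> F})"
    by (rule card_mono[OF _ cover], rule finite_subset[of _ "kneser_vertices n k"]) auto
  also have "\<dots> \<le> (\<Sum>s\<in>{1..?m}. card (\<Union>Q\<in>Qs s. \<Union>R\<in>Rs s. \<Union>S\<in>Ss Q s.
        {F \<in> kneser_vertices n k. Q \<union> R \<union> S \<subseteq> F}))"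
    by (rule card_UN_le) simp
  also have "\<dots> \<le> (\<Sum>s = 1..?m. ?a s * (?b s * (?c s * ?d s)))"
    using block by (intro sum_mono)
  finally show ?thesis by (simp add: mult.assoc)
qed

section \<open>The Erdos-Ko-Rado bound\<close>

definition t_intersecting :: "nat \<Rightarrow> nat set set \<Rightarrow> bool" where
  "t_intersecting t \<F> \<longleftrightarrow> (\<forall>F\<in>\<F>. \<forall>G\<in>\<F>. t \<le> card (F \<inter> G))"

definition maximum_family :: "nat \<Rightarrow> nat \<Rightarrow> nat \<Rightarrow> nat set set \<Rightarrow> bool" where
  "maximum_family n k t \<F> \<longleftrightarrow> \<F> \<subseteq> kneser_vertices n k \<and> t_intersecting t \<F> \<and>
     (\<forall>\<G>. \<G> \<subseteq> kneser_vertices n k \<and> t_intersecting t \<G> \<longrightarrow> card \<G> \<le> card \<F>)"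

text \<open>In the language of Ahlswede and Khachatryan: families with a generating set on
  \<open>{1..m}\<close>. The condition weakens as \<open>m\<close> grows.\<close>

definition prefix_closed :: "nat \<Rightarrow> nat \<Rightarrow> nat \<Rightarrow> nat set set \<Rightarrow> bool" where
  "prefix_closed n k m \<F> \<longleftrightarrow>
     (\<forall>F\<in>\<F>. \<forall>G\<in>kneser_vertices n k. F \<inter> {1..m} \<subseteq> G \<longrightarrow> G \<in> \<F>)"

definition left_compressed :: "nat set set \<Rightarrow> bool" where
  "left_compressed \<F> \<longleftrightarrow>
     (\<forall>F\<in>\<F>. \<forall>x y. 1 \<le> x \<and> x < y \<and> y \<in> F \<and> x \<notin> F \<longrightarrow> insert x (F - {y}) \<in> \<F>)"

lemma maximum_familyD:
  assumes "maximum_family n k t \<F>"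
  shows "\<F> \<subseteq> kneser_vertices n k" "t_intersecting t \<F>" "finite \<F>"
    "\<And>\<G>. \<G> \<subseteq> kneser_vertices n k \<Longrightarrow> t_intersecting t \<G> \<Longrightarrow> card \<G> \<le> card \<F>"
  using assms finite_subset[OF _ finite_kneser_vertices] unfolding maximum_family_def by blast+

lemma t_intersectingD: "t_intersecting t \<F> \<Longrightarrow> F \<in> \<F> \<Longrightarrow> G \<in> \<F> \<Longrightarrow> t \<le> card (F \<inter> G)"
  unfolding t_intersecting_def by blast

lemma left_compressedD:
  "left_compressed \<F> \<Longrightarrow> F \<in> \<F> \<Longrightarrow> 1 \<le> x \<Longrightarrow> x < y \<Longrightarrow> y \<in> F \<Longrightarrow> x \<notin> F \<Longrightarrow> insert x (F - {y}) \<in> \<F>"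
  unfolding left_compressed_def by blast

lemma prefix_closedD:
  "prefix_closed n k m \<F> \<Longrightarrow> F \<in> \<F> \<Longrightarrow> G \<in> kneser_vertices n k \<Longrightarrow> F \<inter> {1..m} \<subseteq> G \<Longrightarrow> G \<in> \<F>"
  unfolding prefix_closed_def by blast

section \<open>Shifting and left-compressed maximum families\<close>

lemma maximum_family_exists: "\<exists>\<F>. maximum_family n k t \<F>"
proof -
  let ?P = "\<lambda>\<F>. \<F> \<subseteq> kneser_vertices n k \<and> t_intersecting t \<F>"
  have "?P {}" unfolding t_intersecting_def by simp
  moreover have "card \<F> \<le> card (kneser_vertices n k)" if "?P \<F>" for \<F>
    using that by (intro card_mono) auto
  ultimately obtain \<F> where "?P \<F>" "\<And>\<G>. ?P \<G> \<Longrightarrow> card \<G> \<le> card \<F>"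
    using ex_has_greatest_nat[of ?P "{}" card "card (kneser_vertices n k)"]
    by (metis le_eq_less_or_eq less_Suc_eq_le)
  then show ?thesis unfolding maximum_family_def by blast
qed

text \<open>The shifting operator of Erdos, Ko and Rado. A set whose shift is already present stays
  put, which keeps the operator injective on the family.\<close>

definition shift_set :: "nat \<Rightarrow> nat \<Rightarrow> nat set set \<Rightarrow> nat set \<Rightarrow> nat set" where
  "shift_set x y \<F> F =
     (if y \<in> F \<and> x \<notin> F \<and> insert x (F - {y}) \<notin> \<F> then insert x (F - {y}) else F)"

lemma swap_in_kneser_vertices:
  assumes "F \<in> kneser_vertices n k" "y \<in> F" "x \<notin> F" "x \<in> {1..n}"
  shows "insert x (F - {y}) \<in> kneser_vertices n k"
proof -
  have "0 < card F" using assms kneser_verticesD(3)[OF assms(1)] by (auto simp: card_gt_0_iff)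
  then show ?thesis
    using assms kneser_verticesD(3)[OF assms(1)] unfolding kneser_vertices_def by auto
qed

lemma inj_on_shift_set: "inj_on (shift_set x y \<F>) \<F>"
proof (rule inj_onI)
  fix F G assume FG: "F \<in> \<F>" "G \<in> \<F>" and eq: "shift_set x y \<F> F = shift_set x y \<F> G"
  have "F = G" if "y \<in> F" "x \<notin> F" "y \<in> G" "x \<notin> G" "insert x (F - {y}) = insert x (G - {y})"
    using that by (metis Diff_insert_absorb insert_Diff insert_iff)
  with eq FG show "F = G" unfolding shift_set_def by (auto split: if_splits)
qed

text \<open>The delicate pair is a moved \<open>F\<close> and a \<open>G\<close> that contains
  \<open>y\<close> but not \<open>x\<close> and stays. Then the shift of \<open>G\<close> is itself
  a member, and \<open>F\<close> meets it in exactly as many elements as the moved \<open>F\<close>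
  meets \<open>G\<close>.\<close>

lemma t_intersecting_shift:
  assumes int: "t_intersecting t \<F>" and fin: "\<And>F. F \<in> \<F> \<Longrightarrow> finite F" and xy: "x \<noteq> y"
  shows "t_intersecting t (shift_set x y \<F> ` \<F>)"
proof -
  have moved: "t \<le> card (insert x (F - {y}) \<inter> G)"
    if F: "F \<in> \<F>" "y \<in> F" "x \<notin> F" and G: "G \<in> \<F>" "y \<in> G \<and> x \<notin> G \<longrightarrow> insert x (G - {y}) \<in> \<F>"
    for F G
  proof -
    have finFG: "finite (F \<inter> G)" using fin F by blast
    consider "x \<in> G" | "x \<notin> G" "y \<notin> G" | "x \<notin> G" "y \<in> G" by blast
    then show ?thesis
    proof cases
      case 1
      then have "insert x (F - {y}) \<inter> G = insert x (F \<inter> G - {y})" by blast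
      moreover have "card (F \<inter> G) \<le> card (insert x (F \<inter> G - {y}))"
        using finFG F by (cases "y \<in> F \<inter> G") (auto simp: card.insert_remove card_Diff_singleton_if)
      ultimately show ?thesis using t_intersectingD[OF int F(1) G(1)] by simp
    next
      case 2
      then have "insert x (F - {y}) \<inter> G = F \<inter> G" by blast
      then show ?thesis using t_intersectingD[OF int F(1) G(1)] by simp
    next
      case 3
      then have "insert x (F - {y}) \<inter> G = F \<inter> insert x (G - {y})" using F by blast
      then show ?thesis using t_intersectingD[OF int F(1), of "insert x (G - {y})"] G 3 by simp
    qed
  qed
  have both: "t \<le> card (insert x (F - {y}) \<inter> insert x (G - {y}))"
    if "F \<in> \<F>" "y \<in> F" "x \<notin> F" "G \<in> \<F>" "y \<in> G" "x \<notin> G" for F G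
  proof -
    have finFG: "finite (F \<inter> G)" using fin that by blast
    have "insert x (F - {y}) \<inter> insert x (G - {y}) = insert x (F \<inter> G - {y})" by blast
    moreover have "0 < card (F \<inter> G)" using finFG that by (auto simp: card_gt_0_iff)
    ultimately show ?thesis
      using t_intersectingD[OF int that(1,4)] finFG that by simp
  qed
  show ?thesis
    unfolding t_intersecting_def
  proof (intro ballI)
    fix F' G' assume "F' \<in> shift_set x y \<F> ` \<F>" "G' \<in> shift_set x y \<F> ` \<F>"
    then obtain F G where FG: "F \<in> \<F>" "G \<in> \<F>" "F' = shift_set x y \<F> F" "G' = shift_set x y \<F> G"
      by blast
    then show "t \<le> card (F' \<inter> G')"
      using moved[of F G] moved[of G F] both[of F G] t_intersectingD[OF int FG(1,2)]
      unfolding shift_set_def by (auto simp: Int_commute)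
  qed
qed

text \<open>Because \<open>x < y\<close>, a shift never takes \<open>y\<close> out of a trace
  without putting \<open>x\<close> into it: if \<open>x\<close> lies beyond the prefix, so does
  \<open>y\<close>, and the trace is unchanged.\<close>

lemma prefix_closed_shift:
  assumes pc: "prefix_closed n k m \<F>" and V: "\<F> \<subseteq> kneser_vertices n k"
    and xy: "x < y" "x \<in> {1..n}" "y \<in> {1..n}"
  shows "prefix_closed n k m (shift_set x y \<F> ` \<F>)"
  unfolding prefix_closed_def
proof (intro ballI impI)
  fix F' G assume F': "F' \<in> shift_set x y \<F> ` \<F>" and G: "G \<in> kneser_vertices n k"
    and sub: "F' \<inter> {1..m} \<subseteq> G"
  let ?sw = "\<lambda>A. insert x (A - {y})"
  \<comment> \<open>\<open>stay\<close> and \<open>come\<close> cover the two ways to be in the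
    shifted family: as a member that does not move, or as the image of
    \<open>insert y (G - {x})\<close>.\<close>
  have stay: "G \<in> shift_set x y \<F> ` \<F>" if "G \<in> \<F>" "y \<in> G \<and> x \<notin> G \<longrightarrow> ?sw G \<in> \<F>"
  proof -
    have "shift_set x y \<F> G = G" using that unfolding shift_set_def by auto
    then show ?thesis using that(1) by (metis image_eqI)
  qed
  have come: "G \<in> shift_set x y \<F> ` \<F>" if "insert y (G - {x}) \<in> \<F>" "x \<in> G" "y \<notin> G"
  proof (cases "G \<in> \<F>")
    case True
    then show ?thesis using stay that by blast
  next
    case False
    have "?sw (insert y (G - {x})) = G" using that xy by blast
    then have "shift_set x y \<F> (insert y (G - {x})) = G"
      using False xy unfolding shift_set_def by auto
    then show ?thesis using that(1) by (metis image_eqI)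
  qed
  have swG: "?sw G \<in> kneser_vertices n k" if "y \<in> G" "x \<notin> G"
    using swap_in_kneser_vertices[OF G that] xy by simp
  have swG': "insert y (G - {x}) \<in> kneser_vertices n k" if "x \<in> G" "y \<notin> G"
    using swap_in_kneser_vertices[OF G that] xy by simp
  have up: "A \<in> \<F>" if "B \<in> \<F>" "A \<in> kneser_vertices n k" "B \<inter> {1..m} \<subseteq> A" for A B
    using prefix_closedD[OF pc that] .
  obtain F where F: "F \<in> \<F>" "F' = shift_set x y \<F> F" using F' by blast
  show "G \<in> shift_set x y \<F> ` \<F>"
  proof (cases "y \<in> F \<and> x \<notin> F \<and> ?sw F \<notin> \<F>")
    case True
    then have sub': "?sw F \<inter> {1..m} \<subseteq> G" using sub F unfolding shift_set_def by simp
    show ?thesis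
    proof (cases "x \<in> G \<and> y \<notin> G")
      case True
      then have "insert y (G - {x}) \<in> \<F>"
        using up[OF F(1) swG'] sub' \<open>y \<in> F \<and> x \<notin> F \<and> ?sw F \<notin> \<F>\<close> by blast
      then show ?thesis using come True by blast
    next
      case False
      have xG: "x \<in> G \<or> m < x" using sub' xy(2) by auto
      have "G \<in> \<F>"
        using up[OF F(1) G] sub' False xG xy by force
      moreover have "?sw G \<in> \<F>" if "y \<in> G" "x \<notin> G"
        using up[OF F(1) swG] that sub' xG xy by force
      ultimately show ?thesis using stay by blast
    qed
  next
    case False
    then have F'F: "F' = F" using F unfolding shift_set_def by auto
    have "G \<in> \<F>" using up[OF F(1) G] sub F'F by blast
    moreover have "?sw G \<in> \<F>" if "y \<in> G" "x \<notin> G"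
    proof (cases "y \<in> F \<and> x \<notin> F")
      case True
      then have "?sw F \<in> \<F>" using False by blast
      then show ?thesis using up[OF _ swG[OF that], of "?sw F"] sub F'F by blast
    next
      case False
      show ?thesis
      proof (cases "y \<in> F")
        case True
        then have "x \<in> F" using False by blast
        then have "m < x" using sub F'F that xy by auto
        then show ?thesis using up[OF F(1) swG[OF that]] sub F'F xy by force
      next
        case False
        then show ?thesis using up[OF F(1) swG[OF that]] sub F'F by blast
      qed
    qed
    ultimately show ?thesis using stay by blast
  qed
qed

lemma maximum_family_shift:
  assumes "maximum_family n k t \<F>" "x < y" "x \<in> {1..n}" "y \<in> {1..n}"
  shows "maximum_family n k t (shift_set x y \<F> ` \<F>)"
proof -
  note max = maximum_familyD[OF assms(1)]
  have "shift_set x y \<F> ` \<F> \<subseteq> kneser_vertices n k"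
    using max(1) swap_in_kneser_vertices[of _ n k y x] assms(3) unfolding shift_set_def by auto
  moreover have "t_intersecting t (shift_set x y \<F> ` \<F>)"
  proof (rule t_intersecting_shift[OF max(2)])
    show "finite F" if "F \<in> \<F>" for F
      using that max(1) kneser_verticesD(3) by blast
    show "x \<noteq> y" using assms(2) by simp
  qed
  ultimately show ?thesis
    using max(4) unfolding maximum_family_def by (auto simp: card_image[OF inj_on_shift_set])
qed

text \<open>Every shift that moves a set lowers the sum of all elements of all members, so a family
  minimizing this sum is compressed.\<close>

lemma left_compressed_maximum_family_exists:
  assumes "maximum_family n k t \<F>" "prefix_closed n k m \<F>"
  shows "\<exists>\<G>. maximum_family n k t \<G> \<and> prefix_closed n k m \<G> \<and> left_compressed \<G>"
proof -
  define w where "w \<G> = (\<Sum>F\<in>\<G>. \<Sum>F)" for \<G> :: "nat set set"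
  let ?P = "\<lambda>\<G>. maximum_family n k t \<G> \<and> prefix_closed n k m \<G>"
  obtain \<G> where G: "?P \<G>" and w_min: "\<And>\<H>. ?P \<H> \<Longrightarrow> w \<G> \<le> w \<H>"
    using ex_has_least_nat[of ?P \<F> w] assms by blast
  note max = maximum_familyD[OF conjunct1[OF G]]
  have "insert x (F - {y}) \<in> \<G>" if F: "F \<in> \<G>" and xy: "1 \<le> x" "x < y" "y \<in> F" "x \<notin> F" for F x y
  proof (rule ccontr)
    assume moved: "insert x (F - {y}) \<notin> \<G>"
    have n: "y \<in> {1..n}" "x \<in> {1..n}"
      using F xy kneser_verticesD(1)[OF subsetD[OF max(1) F]] by auto
    have less: "\<Sum>(insert x (A - {y})) < \<Sum>A" if "A \<in> \<G>" "y \<in> A" "x \<notin> A" for A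
    proof -
      have "finite A" using that max(1) kneser_verticesD(3) by blast
      then show ?thesis using that xy by (simp add: sum.remove[of A y])
    qed
    have "w (shift_set x y \<G> ` \<G>) = (\<Sum>A\<in>\<G>. \<Sum>(shift_set x y \<G> A))"
      unfolding w_def by (simp add: sum.reindex[OF inj_on_shift_set])
    also have "\<dots> < w \<G>"
      unfolding w_def
    proof (rule sum_strict_mono_ex1[OF max(3)])
      show "\<forall>A\<in>\<G>. \<Sum>(shift_set x y \<G> A) \<le> \<Sum>A"
        using less unfolding shift_set_def by (auto intro: less_imp_le)
      show "\<exists>A\<in>\<G>. \<Sum>(shift_set x y \<G> A) < \<Sum>A"
        using less F xy moved unfolding shift_set_def by (intro bexI[of _ F]) auto
    qed
    finally show False
      using w_min[of "shift_set x y \<G> ` \<G>"] G maximum_family_shift prefix_closed_shift[OF _ max(1)] xy n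
      by (meson leD)
  qed
  then show ?thesis using G unfolding left_compressed_def by blast
qed

text \<open>If \<open>F\<close> and \<open>G\<close> share some \<open>y\<close> beyond the prefix,
  their union, of size at most 2k - t, leaves some \<open>x\<close> of the prefix uncovered.
  Replacing \<open>y\<close> by \<open>x\<close> in \<open>F\<close> keeps the intersection inside
  the prefix and shrinks the part beyond it.\<close>

lemma left_compressed_prefix_intersection:
  assumes lc: "left_compressed \<F>" and int: "t_intersecting t \<F>" and V: "\<F> \<subseteq> kneser_vertices n k"
    and "F \<in> \<F>" "G \<in> \<F>"
  shows "t \<le> card (F \<inter> G \<inter> {1..2 * k - t})"
  using \<open>F \<in> \<F>\<close>
proof (induction "card (F \<inter> G - {1..2 * k - t})" arbitrary: F rule: less_induct)
  case less
  let ?q = "{1..2 * k - t}"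
  note F = kneser_verticesD[OF subsetD[OF V less.prems]]
    and G = kneser_verticesD[OF subsetD[OF V \<open>G \<in> \<F>\<close>]]
  have tc: "t \<le> card (F \<inter> G)" by (rule t_intersectingD[OF int less.prems \<open>G \<in> \<F>\<close>])
  have split: "card (F \<inter> G) = card (F \<inter> G \<inter> ?q) + card (F \<inter> G - ?q)"
    using F(3) by (metis card_Int_Diff finite_Int)
  show ?case
  proof (cases "F \<inter> G - ?q = {}")
    case True
    then have "card (F \<inter> G - ?q) = 0" by (simp only: card.empty)
    then show ?thesis using split tc by linarith
  next
    case False
    then obtain y where y: "y \<in> F" "y \<in> G" "y \<notin> ?q" by blast
    have "y \<noteq> 0" using y(1) F(1) by auto
    have "card (F \<union> G) \<le> 2 * k - t"
      using card_Un_Int[OF F(3) G(3)] tc F(2) G(2) by linarith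
    then have "card ((F \<union> G) - {y}) < card ?q"
    proof -
      assume "card (F \<union> G) \<le> 2 * k - t"
      moreover have "card (F \<union> G - {y}) < card (F \<union> G)"
        using y F(3) G(3) by (intro card_Diff1_less) auto
      ultimately show ?thesis by simp
    qed
    then have "\<not> ?q \<subseteq> F \<union> G - {y}"
      using F(3) G(3) card_mono[of "F \<union> G - {y}" ?q] by auto
    then obtain x where x: "x \<in> ?q" "x \<notin> F" "x \<notin> G" using y by blast
    let ?F = "insert x (F - {y})"
    have "?F \<in> \<F>"
      using left_compressedD[OF lc less.prems, of x y] x y \<open>y \<noteq> 0\<close> by auto
    moreover have "x \<noteq> y" using x y by blast
    then have "?F \<inter> G - ?q \<subseteq> F \<inter> G - ?q" "y \<in> F \<inter> G - ?q" "y \<notin> ?F \<inter> G - ?q"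
      using x y by blast+
    then have "?F \<inter> G - ?q \<subset> F \<inter> G - ?q" by blast
    then have "card (?F \<inter> G - ?q) < card (F \<inter> G - ?q)"
      using F(3) by (intro psubset_card_mono) auto
    ultimately have "t \<le> card (?F \<inter> G \<inter> ?q)" using less.hyps by blast
    moreover have "?F \<inter> G \<inter> ?q = F \<inter> G \<inter> ?q" using x y by blast
    ultimately show ?thesis by simp
  qed
qed

text \<open>A \<open>k\<close>-set containing the trace of a member meets every member in
  \<open>t\<close> elements inside the prefix, so maximality forces it into the family. This bounds
  the shortest prefix by 2k - t.\<close>

lemma prefix_closed_left_compressed_maximum:
  assumes max: "maximum_family n k t \<F>" and lc: "left_compressed \<F>" and "t \<le> k"
  shows "prefix_closed n k (2 * k - t) \<F>"
  unfolding prefix_closed_def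
proof (intro ballI impI, rule ccontr)
  note max' = maximum_familyD[OF max]
  fix F G assume F: "F \<in> \<F>" and G: "G \<in> kneser_vertices n k" "F \<inter> {1..2 * k - t} \<subseteq> G" "G \<notin> \<F>"
  note G' = kneser_verticesD[OF G(1)]
  have "t \<le> card (G \<inter> A)" if "A \<in> \<F>" for A
  proof -
    have "t \<le> card (F \<inter> A \<inter> {1..2 * k - t})"
      by (rule left_compressed_prefix_intersection[OF lc max'(2,1) F that])
    also have "\<dots> \<le> card (G \<inter> A)" using G G' by (intro card_mono) auto
    finally show ?thesis .
  qed
  then have "t_intersecting t (insert G \<F>)"
    using max'(2) G' \<open>t \<le> k\<close> unfolding t_intersecting_def by (auto simp: Int_commute)
  then have "card (insert G \<F>) \<le> card \<F>" using max'(1,4) G(1) by simp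
  then show False using G(3) max'(3) by simp
qed

section \<open>Traces of a maximum family on a shortest prefix\<close>

lemma card_diff_singleton_less:
  assumes "finite A" "t \<le> card A" "card (A - {m}) < t"
  shows "m \<in> A" "card A = t"
proof -
  show m: "m \<in> A"
  proof (rule ccontr)
    assume "m \<notin> A"
    then have "A - {m} = A" by blast
    with assms show False by simp
  qed
  with assms show "card A = t" by simp
qed

text \<open>\<open>m_min\<close> ranges over all maximum families because the rivals built below are
  not known to be left compressed. \<open>n_gr\<close> and \<open>m_le\<close> give
  \<open>k - t < n - m\<close>, the room beyond the prefix.\<close>

locale minimal_prefix_family =
  fixes n k t m :: nat and \<F> :: "nat set set"
  assumes max: "maximum_family n k t \<F>" and pc: "prefix_closed n k m \<F>"
    and lc: "left_compressed \<F>"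
    and m_min: "\<And>\<G>. maximum_family n k t \<G> \<Longrightarrow> \<not> prefix_closed n k (m - 1) \<G>"
    and m_pos: "0 < m" and m_le: "m \<le> 2 * k - t" and t_pos: "0 < t" and t_le: "t \<le> k"
    and n_ge: "2 * k \<le> n" and n_gr: "3 * k < n + 2 * t"
begin

definition traces :: "nat set set" where
  "traces = (\<lambda>F. F \<inter> {1..m}) ` \<F>"

text \<open>By \<open>traces_upward\<close> and \<open>traces_shift\<close> these are the
  inclusion-minimal traces that contain \<open>m\<close>.\<close>

definition boundary :: "nat set set" where
  "boundary = {E \<in> traces. m \<in> E \<and> E - {m} \<notin> traces}"

definition fam :: "nat set set \<Rightarrow> nat set set" where
  "fam \<S> = {F \<in> kneser_vertices n k. F \<inter> {1..m} \<in> \<S>}"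

lemmas max_facts = maximum_familyD[OF max]

lemma m_le_n: "m \<le> n"
  using m_le n_ge by simp

lemma fam_traces: "fam traces = \<F>"
proof (intro equalityI subsetI)
  fix F assume "F \<in> fam traces"
  then obtain G where "G \<in> \<F>" "F \<in> kneser_vertices n k" "F \<inter> {1..m} = G \<inter> {1..m}"
    unfolding fam_def traces_def by auto
  then show "F \<in> \<F>" using prefix_closedD[OF pc, of G F] by blast
next
  fix F assume "F \<in> \<F>"
  then show "F \<in> fam traces" using max_facts(1) unfolding fam_def traces_def by blast
qed

lemma traceE:
  assumes "E \<in> traces"
  obtains F where "F \<in> \<F>" "F \<in> kneser_vertices n k" "F \<inter> {1..m} = E"
  using assms max_facts(1) unfolding traces_def by blast

lemma traceD:
  assumes "E \<in> traces"
  shows "E \<subseteq> {1..m}" "finite E" "card E \<le> k"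
proof -
  obtain F where F: "F \<in> kneser_vertices n k" "F \<inter> {1..m} = E" using traceE[OF assms] by blast
  show "E \<subseteq> {1..m}" "finite E" using F by auto
  show "card E \<le> k" using F kneser_verticesD(2,3)[OF F(1)] card_mono[of F E] by blast
qed

lemma finite_traces [simp]: "finite traces"
  using max_facts(3) unfolding traces_def by simp

lemma finite_boundary [simp]: "finite boundary"
  unfolding boundary_def by simp

lemma boundaryD:
  assumes "E \<in> boundary"
  shows "E \<in> traces" "m \<in> E" "E - {m} \<notin> traces"
  using assms unfolding boundary_def by auto

lemma traces_upward:
  assumes E: "E \<in> traces" and sub: "E \<subseteq> E'" "E' \<subseteq> {1..m}" and k: "card E' \<le> k"
  shows "E' \<in> traces"
proof -
  obtain F where F: "F \<in> \<F>" "F \<in> kneser_vertices n k" "F \<inter> {1..m} = E" using traceE[OF E] by blast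
  note F' = kneser_verticesD[OF F(2)]
  have finE': "finite E'" using sub(2) finite_subset by blast
  have "card F = card E + card (F - {1..m})"
    using card_Int_Diff[OF F'(3), of "{1..m}"] F(3) by simp
  then have "k - card E' \<le> card (F - {1..m})"
    using F'(2) card_mono[OF finE' sub(1)] by simp
  then obtain X where X: "X \<subseteq> F - {1..m}" "card X = k - card E'"
    by (meson obtain_subset_with_card_n)
  have "E' \<inter> X = {}" "finite X" using X(1) sub(2) F'(3) by (auto intro: finite_subset)
  then have "card (E' \<union> X) = k"
    using X(2) k finE' by (simp add: card_Un_disjoint)
  moreover have "E' \<union> X \<subseteq> {1..n}" using X(1) sub(2) F'(1) m_le_n by auto
  ultimately have V: "E' \<union> X \<in> kneser_vertices n k" unfolding kneser_vertices_def by simp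
  moreover have "F \<inter> {1..m} \<subseteq> E' \<union> X" using F(3) sub(1) by blast
  ultimately have "E' \<union> X \<in> \<F>" using prefix_closedD[OF pc F(1)] by blast
  moreover have "(E' \<union> X) \<inter> {1..m} = E'" using sub(2) X(1) by blast
  ultimately show ?thesis unfolding traces_def by blast
qed

text \<open>Since \<open>2 * k \<le> n\<close>, the set \<open>G\<close> can be completed to a
  member by elements outside \<open>F\<close>; the intersection with \<open>F\<close> is then just
  \<open>E \<inter> G\<close>.\<close>

lemma traces_intersect:
  assumes E: "E \<in> traces" and G: "G \<in> traces"
  shows "t \<le> card (E \<inter> G)"
proof -
  obtain F where F: "F \<in> \<F>" "F \<in> kneser_vertices n k" "F \<inter> {1..m} = E" using traceE[OF E] by blast
  obtain F' where F': "F' \<in> \<F>" "F' \<inter> {1..m} = G" using traceE[OF G] by blast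
  note kF = kneser_verticesD[OF F(2)]
  have finG: "finite G" using traceD(2)[OF G] .
  have G_sub: "G \<subseteq> {1..m}" "card G \<le> k" using traceD[OF G] by auto
  have "F \<union> G \<subseteq> {1..n}" using kF(1) G_sub m_le_n by auto
  then have "card ({1..n} - (F \<union> G)) = n - card (F \<union> G)"
    using kF(3) finG by (subst card_Diff_subset) auto
  moreover have "card (F \<union> G) \<le> k + card G"
    using card_Un_le[of F G] kF(2) by simp
  ultimately have "k - card G \<le> card ({1..n} - (F \<union> G))" using n_ge by simp
  then obtain X where X: "X \<subseteq> {1..n} - (F \<union> G)" "card X = k - card G"
    by (meson obtain_subset_with_card_n)
  have "finite X" "G \<inter> X = {}" using X(1) finite_subset by auto
  then have "card (G \<union> X) = k"
    using X(2) G_sub(2) finG by (simp add: card_Un_disjoint)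
  then have "G \<union> X \<in> kneser_vertices n k"
    using X(1) G_sub(1) m_le_n unfolding kneser_vertices_def by auto
  then have "G \<union> X \<in> \<F>" using prefix_closedD[OF pc F'(1)] F'(2) by blast
  then have "t \<le> card (F \<inter> (G \<union> X))" by (rule t_intersectingD[OF max_facts(2) F(1)])
  moreover have "F \<inter> (G \<union> X) = E \<inter> G" using X(1) G_sub(1) F(3) by blast
  ultimately show ?thesis by simp
qed

lemma card_trace_ge: "E \<in> traces \<Longrightarrow> t \<le> card E"
  using traces_intersect[of E E] by simp

lemma traces_shift:
  assumes E: "E \<in> traces" and xy: "x \<in> {1..m}" "x < y" "y \<in> E" "x \<notin> E"
  shows "insert x (E - {y}) \<in> traces"
proof -
  obtain F where F: "F \<in> \<F>" "F \<inter> {1..m} = E" using traceE[OF E] by blast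
  have "insert x (F - {y}) \<in> \<F>"
    using left_compressedD[OF lc F(1), of x y] xy F(2) by auto
  moreover have "insert x (F - {y}) \<inter> {1..m} = insert x (E - {y})" using xy F(2) by auto
  ultimately show ?thesis unfolding traces_def by blast
qed

text \<open>If some \<open>x\<close> were in neither set, shifting \<open>m\<close> to
  \<open>x\<close> in \<open>E\<close> would lose the common element \<open>m\<close> and gain none,
  leaving \<open>t - 1\<close>.\<close>

lemma tight_pair:
  assumes E: "E \<in> traces" "m \<in> E" and G: "G \<in> traces" "m \<in> G" and tight: "card (E \<inter> G) = t"
  shows "E \<union> G = {1..m}" "card E + card G = m + t"
proof -
  show un: "E \<union> G = {1..m}"
  proof (rule ccontr)
    assume "E \<union> G \<noteq> {1..m}"
    then obtain x where x: "x \<in> {1..m}" "x \<notin> E" "x \<notin> G"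
      using traceD(1)[OF E(1)] traceD(1)[OF G(1)] by blast
    then have "x < m" using E(2) by (cases "x = m") auto
    have "t \<le> card (insert x (E - {m}) \<inter> G)"
      using traces_intersect[OF traces_shift[OF E(1) x(1) \<open>x < m\<close> E(2) x(2)] G(1)] .
    also have "insert x (E - {m}) \<inter> G = E \<inter> G - {m}" using x by blast
    finally show False
      using tight t_pos E(2) G(2) traceD(2)[OF E(1)] by simp
  qed
  show "card E + card G = m + t"
    using card_Un_Int[OF traceD(2)[OF E(1)] traceD(2)[OF G(1)]] un tight by simp
qed

text \<open>Describes the only traces that prevent \<open>m\<close> from being deleted from
  \<open>E\<close>: they contain \<open>m\<close> and meet \<open>E\<close> in exactly
  \<open>t\<close> elements, so \<open>tight_pair\<close> applies.\<close>

lemma boundary_conflict: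
  assumes E: "E \<in> boundary" and G: "G \<in> traces" and less: "card ((E - {m}) \<inter> G) < t"
  shows "G \<in> boundary" "E \<union> G = {1..m}" "card E + card G = m + t"
proof -
  note E' = boundaryD[OF E]
  have fin: "finite (E \<inter> G)" using traceD(2)[OF G] by blast
  have eq: "(E - {m}) \<inter> G = E \<inter> G - {m}" "E \<inter> (G - {m}) = E \<inter> G - {m}" by blast+
  note diff = card_diff_singleton_less[OF fin traces_intersect[OF E'(1) G] less[unfolded eq(1)]]
  have m: "m \<in> G" and tight: "card (E \<inter> G) = t" using diff by simp_all
  have "G - {m} \<notin> traces"
    using traces_intersect[OF E'(1), of "G - {m}"] less unfolding eq by linarith
  with G m show "G \<in> boundary" unfolding boundary_def by blast
  show "E \<union> G = {1..m}" "card E + card G = m + t"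
    using tight_pair[OF E'(1,2) G m tight] by auto
qed

section \<open>Exchanging boundary traces\<close>

lemma card_fam:
  assumes "\<And>E. E \<in> \<S> \<Longrightarrow> E \<subseteq> {1..m} \<and> card E \<le> k"
  shows "card (fam \<S>) = (\<Sum>E\<in>\<S>. n - m choose (k - card E))"
proof -
  have fin: "finite \<S>" using assms by (intro finite_subset[of \<S> "Pow {1..m}"]) auto
  have "fam \<S> = (\<Union>E\<in>\<S>. {F. F \<subseteq> {1..n} \<and> card F = k \<and> F \<inter> {1..m} = E})"
    unfolding fam_def kneser_vertices_def by blast
  then have "card (fam \<S>) = (\<Sum>E\<in>\<S>. card {F. F \<subseteq> {1..n} \<and> card F = k \<and> F \<inter> {1..m} = E})"
    using fin by (simp only:) (intro card_UN_disjoint; force intro: finite_subset[of _ "Pow {1..n}"])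
  also have "\<dots> = (\<Sum>E\<in>\<S>. n - m choose (k - card E))"
  proof (rule sum.cong[OF refl])
    fix E assume "E \<in> \<S>"
    then have "E \<subseteq> {1..n} \<inter> {1..m}" "card E \<le> k" using assms m_le_n by fastforce+
    from card_fixed_trace[OF _ this] m_le_n
    show "card {F. F \<subseteq> {1..n} \<and> card F = k \<and> F \<inter> {1..m} = E} = (n - m choose (k - card E))"
      by (simp add: card_Diff_subset)
  qed
  finally show ?thesis .
qed

text \<open>Traces in \<open>R\<close> are given up and those in \<open>A\<close> are lowered by
  deleting \<open>m\<close>. A set in \<open>A\<close> but not in \<open>R\<close> stays beside its
  lowered copy.\<close>

definition replaced :: "nat set set \<Rightarrow> nat set set \<Rightarrow> nat set set" where
  "replaced R A = traces - R \<union> (\<lambda>E. E - {m}) ` A"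

text \<open>Lowered copies are new traces and one element smaller, whence
  \<open>k + 1 - card E\<close>. The additive form avoids truncated subtraction.\<close>

lemma card_fam_replaced:
  assumes "R \<subseteq> boundary" "A \<subseteq> boundary"
  shows "card (fam (replaced R A)) + (\<Sum>E\<in>R. n - m choose (k - card E)) =
    card \<F> + (\<Sum>E\<in>A. n - m choose (k + 1 - card E))"
proof -
  have R: "R \<subseteq> traces" and finR: "finite R" and finA: "finite A"
    using assms boundaryD(1) finite_subset[OF _ finite_boundary] by blast+
  have lowered: "E \<in> traces \<and> m \<in> E \<and> E - {m} \<notin> traces" if "E \<in> A" for E
    using that assms(2) boundaryD by blast
  have "card (fam (replaced R A)) = (\<Sum>E\<in>replaced R A. n - m choose (k - card E))"
  proof (rule card_fam)
    fix E assume "E \<in> replaced R A"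
    then obtain E' where "E' \<in> traces" "E \<subseteq> E'"
      using lowered unfolding replaced_def by blast
    then show "E \<subseteq> {1..m} \<and> card E \<le> k"
      using traceD[of E'] card_mono[of E' E] by force
  qed
  also have "\<dots> = (\<Sum>E\<in>traces - R. n - m choose (k - card E)) +
      (\<Sum>E\<in>(\<lambda>E. E - {m}) ` A. n - m choose (k - card E))"
    unfolding replaced_def using lowered finA by (intro sum.union_disjoint) auto
  also have "(\<Sum>E\<in>(\<lambda>E. E - {m}) ` A. n - m choose (k - card E)) =
      (\<Sum>E\<in>A. n - m choose (k + 1 - card E))"
  proof (subst sum.reindex)
    show "inj_on (\<lambda>E. E - {m}) A" using lowered by (intro inj_onI) (metis insert_Diff)
    have "k - card (E - {m}) = k + 1 - card E" if "E \<in> A" for E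
    proof -
      have "0 < card E" using lowered[OF that] card_trace_ge t_pos by fastforce
      then show ?thesis using lowered[OF that] traceD(2,3)[of E] by simp
    qed
    then show "sum ((\<lambda>E. n - m choose (k - card E)) \<circ> (\<lambda>E. E - {m})) A =
        (\<Sum>E\<in>A. n - m choose (k + 1 - card E))" by simp
  qed
  finally have "card (fam (replaced R A)) + (\<Sum>E\<in>R. n - m choose (k - card E)) =
      (\<Sum>E\<in>traces - R. n - m choose (k - card E)) + (\<Sum>E\<in>R. n - m choose (k - card E)) +
      (\<Sum>E\<in>A. n - m choose (k + 1 - card E))" by simp
  also have "(\<Sum>E\<in>traces - R. n - m choose (k - card E)) + (\<Sum>E\<in>R. n - m choose (k - card E)) =
      (\<Sum>E\<in>traces. n - m choose (k - card E))"
    using R by (simp add: sum.subset_diff[OF R])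
  also have "\<dots> = card (fam traces)"
    using traceD by (intro card_fam[symmetric]) blast
  finally show ?thesis unfolding fam_traces .
qed

text \<open>By \<open>boundary_conflict\<close>, lowered sets can clash with old traces only on the
  boundary, so \<open>old\<close> checks no others.\<close>

lemma t_intersecting_replaced:
  assumes "R \<subseteq> boundary" "A \<subseteq> boundary"
    and old: "\<And>E G. E \<in> A \<Longrightarrow> G \<in> boundary - R \<Longrightarrow> t \<le> card ((E - {m}) \<inter> G)"
    and new: "\<And>E G. E \<in> A \<Longrightarrow> G \<in> A \<Longrightarrow> t \<le> card ((E - {m}) \<inter> (G - {m}))"
  shows "t_intersecting t (fam (replaced R A))"
proof -
  have A_old: "t \<le> card ((E - {m}) \<inter> G)" if "E \<in> A" "G \<in> traces - R" for E G
    using old[of E G] boundary_conflict(1)[of E G] that assms(2) by force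
  have int: "t \<le> card (E \<inter> G)" if "E \<in> replaced R A" "G \<in> replaced R A" for E G
    using that A_old traces_intersect new unfolding replaced_def by (auto simp: Int_commute)
  show ?thesis unfolding t_intersecting_def
  proof (intro ballI)
    fix F G assume FG: "F \<in> fam (replaced R A)" "G \<in> fam (replaced R A)"
    then have "t \<le> card ((F \<inter> {1..m}) \<inter> (G \<inter> {1..m}))" using int unfolding fam_def by blast
    also have "\<dots> \<le> card (F \<inter> G)"
      using FG kneser_verticesD(3) unfolding fam_def by (intro card_mono) auto
    finally show "t \<le> card (F \<inter> G)" .
  qed
qed

lemma fam_subset: "fam \<S> \<subseteq> kneser_vertices n k"
  unfolding fam_def by blast

lemma replacement_bound:
  assumes "R \<subseteq> boundary" "A \<subseteq> boundary"
    and "\<And>E G. E \<in> A \<Longrightarrow> G \<in> boundary - R \<Longrightarrow> t \<le> card ((E - {m}) \<inter> G)"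
    and "\<And>E G. E \<in> A \<Longrightarrow> G \<in> A \<Longrightarrow> t \<le> card ((E - {m}) \<inter> (G - {m}))"
  shows "(\<Sum>E\<in>A. n - m choose (k + 1 - card E)) \<le> (\<Sum>E\<in>R. n - m choose (k - card E))"
  using max_facts(4)[OF fam_subset t_intersecting_replaced[OF assms]]
    card_fam_replaced[OF assms(1,2)] by linarith

text \<open>Once each boundary trace is dropped or lowered, nothing depends on \<open>m\<close>. The
  critical case is a \<open>g\<close> containing \<open>E - {m}\<close> and some \<open>x\<close>
  outside \<open>E\<close>: shifting \<open>m\<close> to \<open>x\<close> turns \<open>E\<close>
  into a trace below \<open>g\<close> without \<open>m\<close>.\<close>

lemma prefix_closed_replaced:
  assumes A: "A \<subseteq> boundary"
  shows "prefix_closed n k (m - 1) (fam (replaced (boundary - A) A))"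
  unfolding prefix_closed_def
proof (intro ballI impI)
  let ?S = "replaced (boundary - A) A"
  fix F G assume F: "F \<in> fam ?S" and G: "G \<in> kneser_vertices n k" "F \<inter> {1..m - 1} \<subseteq> G"
  define e where "e = F \<inter> {1..m - 1}"
  define g where "g = G \<inter> {1..m}"
  have e_eq: "e = F \<inter> {1..m} - {m}" unfolding e_def using m_pos by auto
  have eg: "e \<subseteq> g" unfolding e_def g_def using G(2) by auto
  have g: "g \<subseteq> {1..m}" "card g \<le> k"
    using kneser_verticesD(2,3)[OF G(1)] card_mono[of G g] unfolding g_def by auto
  \<comment> \<open>A trace below \<open>g\<close> without \<open>m\<close> makes both
    \<open>g\<close> and \<open>g - {m}\<close> traces, so \<open>g\<close> is not on the boundary
    and survives.\<close>
  have up: "g \<in> ?S" if "h \<in> traces" "m \<notin> h" "h \<subseteq> g" for h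
  proof -
    have "finite g" using g(1) finite_subset by blast
    then have "card (g - {m}) \<le> k" using g(2) card_mono[of g "g - {m}"] by fastforce
    then have "g \<in> traces" "g - {m} \<in> traces"
      using traces_upward[OF that(1), of g] traces_upward[OF that(1), of "g - {m}"] that g by blast+
    then show ?thesis unfolding replaced_def using boundaryD(3) by blast
  qed
  have "e \<in> traces \<or> (\<exists>E\<in>A. e = E - {m})"
  proof -
    define f where "f = F \<inter> {1..m}"
    have e: "e = f - {m}" unfolding f_def by (rule e_eq)
    have "f \<in> ?S" using F unfolding fam_def f_def by blast
    then consider "f \<in> A" | "f \<in> traces - boundary" | E where "E \<in> A" "f = E - {m}"
      unfolding replaced_def by blast
    then show ?thesis
    proof cases
      case 1
      then show ?thesis using e by blast
    next
      case 2
      then have "m \<in> f \<Longrightarrow> f - {m} \<in> traces" unfolding boundary_def by blast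
      moreover have "m \<notin> f \<Longrightarrow> f - {m} = f" by blast
      ultimately show ?thesis using 2 e by (cases "m \<in> f") simp_all
    next
      case 3
      then have "e = E - {m}" using e by blast
      with 3 show ?thesis by blast
    qed
  qed
  then have "g \<in> ?S"
  proof
    assume "e \<in> traces"
    then show ?thesis using up eg e_eq by blast
  next
    assume "\<exists>E\<in>A. e = E - {m}"
    then obtain E where E: "E \<in> A" "e = E - {m}" by blast
    note E' = boundaryD[OF subsetD[OF A E(1)]]
    consider "g = e" | "g = E" | x where "x \<in> g" "x \<notin> E"
      using eg E'(2) E(2) by blast
    then show ?thesis
    proof cases
      case 1
      then show ?thesis using E unfolding replaced_def by blast
    next
      case 2
      then show ?thesis using E(1) E'(1) unfolding replaced_def by blast
    next
      case 3
      then have x: "x \<in> {1..m}" "x < m" "x \<notin> E"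
        using g(1) E'(2) by (auto simp: less_le)
      from up[OF traces_shift[OF E'(1) x(1,2) E'(2) x(3)]] x 3 eg E(2) show ?thesis by blast
    qed
  qed
  then show "G \<in> fam ?S" using G(1) unfolding fam_def g_def by blast
qed

text \<open>Strict, because equality would give a maximum family determined by \<open>{1..m - 1}\<close>.\<close>

lemma strict_replacement_bound:
  assumes A: "A \<subseteq> boundary"
    and int: "\<And>E G. E \<in> A \<Longrightarrow> G \<in> A \<Longrightarrow> t \<le> card ((E - {m}) \<inter> (G - {m}))"
  shows "(\<Sum>E\<in>A. n - m choose (k + 1 - card E)) < (\<Sum>E\<in>boundary - A. n - m choose (k - card E))"
proof (rule ccontr)
  assume not_less: "\<not> ?thesis"
  let ?G = "fam (replaced (boundary - A) A)"
  have "t_intersecting t ?G"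
  proof (rule t_intersecting_replaced)
    show "t \<le> card ((E - {m}) \<inter> G)" if "E \<in> A" "G \<in> boundary - (boundary - A)" for E G
    proof -
      have "G \<in> A" using that by blast
      then have "finite G" using A boundaryD(1) traceD(2) by blast
      then have "card ((E - {m}) \<inter> (G - {m})) \<le> card ((E - {m}) \<inter> G)"
        by (intro card_mono) auto
      then show ?thesis using int[OF that(1) \<open>G \<in> A\<close>] by simp
    qed
  qed (use A int in auto)
  moreover have "card \<F> \<le> card ?G"
    using card_fam_replaced[of "boundary - A" A] A not_less by fastforce
  ultimately have "maximum_family n k t ?G"
    using max_facts(4) fam_subset unfolding maximum_family_def by (meson order_trans)
  with m_min prefix_closed_replaced[OF A] show False by blast
qed

lemma boundary_nonempty: "boundary \<noteq> {}"
  using strict_replacement_bound[of "{}"] by auto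

text \<open>Without a partner, \<open>E\<close> could be lowered and nothing dropped, a strict gain
  because \<open>k + 1 - card E \<le> n - m\<close> makes the binomial positive.\<close>

lemma boundary_partner:
  assumes E: "E \<in> boundary"
  shows "\<exists>G\<in>boundary. card E + card G = m + t"
proof (rule ccontr)
  assume no: "\<not> ?thesis"
  note E' = boundaryD[OF E]
  have old: "t \<le> card ((E - {m}) \<inter> G)" if "G \<in> boundary" for G
    using boundary_conflict(3)[OF E, of G] no that boundaryD(1) by force
  have "(E - {m}) \<inter> E = (E - {m}) \<inter> (E - {m})" by blast
  then have "t \<le> card ((E - {m}) \<inter> (E - {m}))"
    using old[OF E] by simp
  then have "(\<Sum>E\<in>{E}. n - m choose (k + 1 - card E)) \<le> (\<Sum>E\<in>({} :: nat set set). n - m choose (k - card E))"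
    using old E by (intro replacement_bound) auto
  moreover have "k + 1 - card E \<le> n - m"
    using card_trace_ge[OF E'(1)] m_le n_gr t_le by linarith
  ultimately show False by (simp add: binomial_eq_0_iff)
qed

end

section \<open>Equal sizes on the boundary and the averaging argument\<close>

lemma Suc_times_binomial_Suc: "Suc a * (N choose Suc a) = (N - a) * (N choose a)"
  by (metis binomial_absorb_comp binomial_absorption)

context minimal_prefix_family
begin

text \<open>If sizes \<open>a\<close> and \<open>b\<close> sum to \<open>m + t\<close> and differ,
  sets of size \<open>a\<close> do not conflict among themselves, so all can be lowered at the cost
  of dropping those of size \<open>b\<close>, and conversely. The two resulting bounds are
  incompatible.\<close>

lemma boundary_uniform:
  assumes E: "E \<in> boundary"
  shows "2 * card E = m + t"
proof (rule ccontr)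
  assume neq: "2 * card E \<noteq> m + t"
  define D where "D a = {E \<in> boundary. card E = a}" for a
  have bound: "card (D a) * (n - m choose (k + 1 - a)) \<le> card (D b) * (n - m choose (k - b))"
    if ab: "a + b = m + t" "a \<noteq> b" for a b
  proof -
    have conflict: "t \<le> card ((E - {m}) \<inter> G)" if "E \<in> D a" "G \<in> boundary" "card G \<noteq> b" for E G
      using boundary_conflict(3)[of E G] that ab boundaryD(1) unfolding D_def by force
    have "(\<Sum>E\<in>D a. n - m choose (k + 1 - card E)) \<le> (\<Sum>E\<in>D b. n - m choose (k - card E))"
    proof (rule replacement_bound)
      show "t \<le> card ((E - {m}) \<inter> G)" if "E \<in> D a" "G \<in> boundary - D b" for E G
        using conflict that unfolding D_def by blast
      have "(E - {m}) \<inter> (G - {m}) = (E - {m}) \<inter> G" for E G :: "nat set" by blast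
      then show "t \<le> card ((E - {m}) \<inter> (G - {m}))" if "E \<in> D a" "G \<in> D a" for E G
        using conflict[OF that(1)] that ab(2) unfolding D_def by simp
    qed (auto simp: D_def)
    then show ?thesis unfolding D_def by simp
  qed
  obtain G where G: "G \<in> boundary" "card E + card G = m + t" using boundary_partner[OF E] by blast
  define a b N where "a = k - card E" and "b = k - card G" and "N = n - m"
  have EG: "t \<le> card E" "card E \<le> k" "t \<le> card G" "card G \<le> k" "card E \<noteq> card G"
    using boundaryD(1)[OF E] boundaryD(1)[OF G(1)] card_trace_ge traceD(3) neq G(2) by auto
  have N: "a + b + 2 \<le> N"
    using EG G(2) n_gr n_ge m_le unfolding a_def b_def N_def by linarith
  define p q where "p = card (D (card E))" and "q = card (D (card G))"
  have "E \<in> D (card E)" "G \<in> D (card G)" "finite (D i)" for i using E G(1) unfolding D_def by auto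
  then have pq: "0 < p * q" unfolding p_def q_def by (auto simp: card_gt_0_iff)
  have 1: "p * (N choose Suc a) \<le> q * (N choose b)"
    using bound[OF G(2) EG(5)] EG unfolding p_def q_def a_def b_def N_def by (simp add: Suc_diff_le)
  have 2: "q * (N choose Suc b) \<le> p * (N choose a)"
    using bound[of "card G" "card E"] G(2) EG
    unfolding p_def q_def a_def b_def N_def by (simp add: Suc_diff_le add.commute)
  \<comment> \<open>The product eliminates the class sizes \<open>p\<close> and \<open>q\<close>. It
    leads to (N - a)(N - b) <= (a + 1)(b + 1), impossible since N >= a + b + 2.\<close>
  have "(p * q) * ((N choose Suc a) * (N choose Suc b)) \<le> (p * q) * ((N choose a) * (N choose b))"
    using mult_le_mono[OF 1 2] by (simp add: mult_ac)
  then have le: "(N choose Suc a) * (N choose Suc b) \<le> (N choose a) * (N choose b)"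
    using pq by (simp only: mult_le_cancel1)
  have "(N - a) * (N - b) * ((N choose a) * (N choose b)) =
      (Suc a * (N choose Suc a)) * (Suc b * (N choose Suc b))"
    unfolding Suc_times_binomial_Suc by (simp add: mult_ac)
  also have "\<dots> = (Suc b * Suc a) * ((N choose Suc a) * (N choose Suc b))" by (simp only: mult_ac)
  also have "\<dots> \<le> (Suc b * Suc a) * ((N choose a) * (N choose b))"
    using le by (rule mult_le_mono2)
  finally have "(N - a) * (N - b) \<le> Suc b * Suc a"
    using N by (simp only: mult_le_cancel2) (simp add: zero_less_binomial_iff)
  moreover have "Suc b * Suc a < (N - a) * (N - b)"
    using N by (intro mult_strict_mono) auto
  ultimately show False by simp
qed

text \<open>When the common boundary size \<open>i\<close> is \<open>t\<close>, also
  \<open>m = t\<close>, and every member contains \<open>{1..t}\<close>. Otherwise the exchange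
  bounds obtained from each \<open>j < m\<close>, summed over \<open>j\<close>, contradict the lower
  bound on \<open>n\<close>.\<close>

lemma card_le_star:
  assumes n: "(t + 1) * (k + 1 - t) \<le> n"
  shows "card \<F> \<le> (n - t choose (k - t))"
proof -
  obtain E where E: "E \<in> boundary" using boundary_nonempty by blast
  note E' = boundaryD[OF E]
  define i where "i = card E"
  have i: "2 * i = m + t" "t \<le> i" "i \<le> k"
    using boundary_uniform[OF E] card_trace_ge[OF E'(1)] traceD(3)[OF E'(1)] unfolding i_def by auto
  have card_D: "card G = i" if "G \<in> boundary" for G
    using boundary_uniform[OF that] i(1) by simp
  show ?thesis
  proof (cases "i = t")
    case True
    then have "E = {1..m}"
      using i traceD(1)[OF E'(1)] by (intro card_subset_eq) (auto simp: i_def)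
    have "\<F> \<subseteq> {F \<in> kneser_vertices n k. E \<subseteq> F}"
    proof
      fix F assume F: "F \<in> \<F>"
      then have "F \<inter> {1..m} \<in> traces" unfolding traces_def by blast
      then have "card E \<le> card (E \<inter> (F \<inter> {1..m}))"
        using traces_intersect[OF E'(1)] True unfolding i_def by simp
      then have "E \<inter> (F \<inter> {1..m}) = E"
        using traceD(2)[OF E'(1)] by (intro card_seteq) auto
      then show "F \<in> {F \<in> kneser_vertices n k. E \<subseteq> F}" using F max_facts(1) by blast
    qed
    then have "card \<F> \<le> card {F \<in> kneser_vertices n k. E \<subseteq> F}"
      by (intro card_mono) simp_all
    also have "\<dots> \<le> (n - t choose (k - t))"
      using True unfolding i_def by (rule card_kneser_supersets_le)
    finally show ?thesis .
  next
    case False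
    define N where "N = n - m"
    \<comment> \<open>Two traces missing \<open>j\<close> cannot cover \<open>{1..m}\<close>, so by
      \<open>boundary_conflict\<close> all of \<open>A j\<close> can be lowered together.\<close>
    define A where "A j = {E \<in> boundary. j \<notin> E}" for j
    have step: "card (A j) * (Suc N choose (k + 1 - i)) < card boundary * (N choose (k - i))"
      if j: "j \<in> {1..m - 1}" for j
    proof -
      have A: "A j \<subseteq> boundary" unfolding A_def by blast
      have "(\<Sum>E\<in>A j. n - m choose (k + 1 - card E)) < (\<Sum>E\<in>boundary - A j. n - m choose (k - card E))"
      proof (rule strict_replacement_bound[OF A])
        fix F G assume FG: "F \<in> A j" "G \<in> A j"
        have "j \<in> {1..m}" using j by auto
        then have "F \<union> G \<noteq> {1..m}" using FG unfolding A_def by blast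
        then have "t \<le> card ((F - {m}) \<inter> G)"
          using boundary_conflict(2)[of F G] FG boundaryD(1) unfolding A_def by force
        moreover have "(F - {m}) \<inter> (G - {m}) = (F - {m}) \<inter> G" by blast
        ultimately show "t \<le> card ((F - {m}) \<inter> (G - {m}))" by simp
      qed
      then have "card (A j) * (N choose (k + 1 - i)) < card (boundary - A j) * (N choose (k - i))"
        using card_D A unfolding N_def by (simp add: subset_iff)
      \<comment> \<open>Adding \<open>card (A j) * (N choose (k - i))\<close> to both sides
        completes Pascal's rule on the left and the whole boundary on the right.\<close>
      moreover have "Suc N choose (k + 1 - i) = (N choose (k + 1 - i)) + (N choose (k - i))"
        using i(3) by (simp add: Suc_diff_le)
      moreover have "card boundary = card (A j) + card (boundary - A j)"
        using A by (metis card_Diff_subset card_mono finite_boundary finite_subset le_add_diff_inverse)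
      ultimately show ?thesis by (simp add: algebra_simps)
    qed
    have m2: "2 \<le> m" using i False by simp
    \<comment> \<open>Double counting: a boundary trace contains \<open>m\<close>, so all
      \<open>m - i\<close> elements it misses lie in \<open>{1..m - 1}\<close>.\<close>
    have count: "(\<Sum>j\<in>{1..m - 1}. card (A j)) = card boundary * (m - i)"
    proof -
      have "(\<Sum>j\<in>{1..m - 1}. card (A j)) = (\<Sum>j\<in>{1..m - 1}. \<Sum>E\<in>boundary. if j \<notin> E then 1 else 0)"
        unfolding A_def by (simp add: sum.If_cases Int_def)
      also have "\<dots> = (\<Sum>E\<in>boundary. \<Sum>j\<in>{1..m - 1}. if j \<notin> E then 1 else 0)"
        by (rule sum.swap)
      also have "\<dots> = (\<Sum>E\<in>boundary. m - i)"
      proof (rule sum.cong[OF refl])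
        fix G assume G: "G \<in> boundary"
        note G' = boundaryD[OF G]
        have "{1..m} = insert m {1..m - 1}" using m_pos by auto
        moreover have "X \<inter> {j. j \<notin> G} = insert m X - G" for X
          using G'(2) by blast
        ultimately have "{1..m - 1} \<inter> {j. j \<notin> G} = {1..m} - G"
          by simp
        moreover have "card ({1..m} - G) = m - i"
          using card_Diff_subset[OF traceD(2,1)[OF G'(1)]] card_D[OF G] by simp
        ultimately show "(\<Sum>j\<in>{1..m - 1}. if j \<notin> G then 1 else 0) = m - i"
          by (simp add: sum.If_cases)
      qed
      finally show ?thesis by simp
    qed
    have "card boundary * (m - i) * (Suc N choose (k + 1 - i)) =
        (\<Sum>j\<in>{1..m - 1}. card (A j) * (Suc N choose (k + 1 - i)))"
      unfolding count[symmetric] by (rule sum_distrib_right)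
    also have "\<dots> < (\<Sum>j\<in>{1..m - 1}. card boundary * (N choose (k - i)))"
      using m2 step by (intro sum_strict_mono) auto
    finally have "card boundary * ((m - i) * (Suc N choose (k + 1 - i))) <
        card boundary * ((m - 1) * (N choose (k - i)))"
      by (simp add: mult_ac)
    then have "(m - i) * (Suc N choose (k + 1 - i)) < (m - 1) * (N choose (k - i))"
      by simp
    then have "(k + 1 - i) * ((m - i) * (Suc N choose (k + 1 - i))) <
        (k + 1 - i) * ((m - 1) * (N choose (k - i)))"
      using i(3) by simp
    moreover have "(k + 1 - i) * (Suc N choose (k + 1 - i)) = Suc N * (N choose (k - i))"
      using Suc_times_binomial[of "k - i" N] i(3) by (simp add: Suc_diff_le)
    then have "(k + 1 - i) * ((m - i) * (Suc N choose (k + 1 - i))) = (m - i) * Suc N * (N choose (k - i))"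
      by (metis mult.assoc mult.left_commute)
    ultimately have "(m - i) * Suc N * (N choose (k - i)) < (k + 1 - i) * (m - 1) * (N choose (k - i))"
      by (simp only: mult.assoc)
    then have less: "(m - i) * Suc N < (k + 1 - i) * (m - 1)" by (rule mult_less_cancel2[THEN iffD1, THEN conjunct2])
    \<comment> \<open>\<open>r\<close> is the excess of \<open>i\<close> over \<open>t\<close>, so m
      = t + 2r and m - i = r.\<close>
    define r e where "r = int i - int t" and "e = int k + 1 - int t"
    have sub: "int (m - i) = r" "int (k + 1 - i) = e - r" "int (m - 1) = int t + 2 * r - 1"
      "int (Suc N) = int n + 1 - int t - 2 * r"
      using i m_pos m_le_n unfolding r_def e_def N_def by auto
    have "int (m - i) * int (Suc N) < int (k + 1 - i) * int (m - 1)"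
      using less by (metis of_nat_less_iff of_nat_mult)
    then have less': "r * (int n + 1 - int t - 2 * r) < (e - r) * (int t + 2 * r - 1)"
      unfolding sub .
    have r: "1 \<le> r" "1 \<le> e" using i False t_le unfolding r_def e_def by auto
    have "(int t + 1) * e \<le> int n"
    proof -
      have "int ((t + 1) * (k + 1 - t)) \<le> int n" using n by (simp only: of_nat_le_iff)
      moreover have "int (k + 1 - t) = e" using t_le unfolding e_def by simp
      ultimately show ?thesis by (simp add: distrib_right)
    qed
    then have "r * ((int t + 1) * e + 1 - int t - 2 * r) \<le> r * (int n + 1 - int t - 2 * r)"
      using r by (intro mult_left_mono) auto
    moreover have "0 \<le> e * ((r - 1) * (int t - 1))"
      using r t_pos by simp
    moreover have "r * ((int t + 1) * e + 1 - int t - 2 * r) - (e - r) * (int t + 2 * r - 1)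
        = e * ((r - 1) * (int t - 1))"
      by (simp add: algebra_simps)
    ultimately show ?thesis using less' by linarith
  qed
qed

end

theorem card_t_intersecting_le:
  assumes t: "0 < t" "t < k" and n: "(t + 1) * (k + 1 - t) \<le> n" "3 * k < n + 2 * t"
    and F: "\<F> \<subseteq> kneser_vertices n k" "t_intersecting t \<F>"
  shows "card \<F> \<le> (n - t choose (k - t))"
proof (cases "\<F> = {}")
  case False
  have n2k: "2 * k \<le> n"
  proof -
    \<comment> \<open>With these parameters (t + 1)(k + 1 - t) = 2k + ab.\<close>
    obtain a b where "t = Suc a" "k = Suc (t + b)"
      using t by (metis Suc_pred less_iff_Suc_add)
    then show ?thesis using n by (simp add: algebra_simps)
  qed
  let ?P = "\<lambda>m. \<exists>\<G>. maximum_family n k t \<G> \<and> prefix_closed n k m \<G>"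
  obtain \<G> where G: "maximum_family n k t \<G>" using maximum_family_exists by blast
  \<comment> \<open>Some prefix is needed to start compressing. The compressed family then has
    prefix 2k - t, and a second compression is made at the least \<open>m\<close>.\<close>
  have "prefix_closed n k n \<G>"
    unfolding prefix_closed_def
  proof (intro ballI impI)
    fix A B assume A: "A \<in> \<G>" and B: "B \<in> kneser_vertices n k" "A \<inter> {1..n} \<subseteq> B"
    note A' = kneser_verticesD[OF subsetD[OF maximum_familyD(1)[OF G] A]]
    have "A = B"
      using A' B kneser_verticesD(2,3)[OF B(1)] by (intro card_subset_eq) auto
    then show "B \<in> \<G>" using A by simp
  qed
  then obtain \<H> where "maximum_family n k t \<H>" "left_compressed \<H>"
    using left_compressed_maximum_family_exists[OF G] by blast
  then have P: "?P (2 * k - t)"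
    using prefix_closed_left_compressed_maximum t(2) by (meson less_imp_le)
  define m where "m = (LEAST m. ?P m)"
  have m: "?P m" "m \<le> 2 * k - t"
    unfolding m_def using P by (rule LeastI, rule Least_le)
  then obtain \<M> where M: "maximum_family n k t \<M>" "prefix_closed n k m \<M>" "left_compressed \<M>"
    using left_compressed_maximum_family_exists by blast
  have card_le: "card \<F> \<le> card \<M>" using maximum_familyD(4)[OF M(1) F] .
  have "m \<noteq> 0"
  proof
    assume "m = 0"
    have "\<M> \<noteq> {}" using card_le False F(1) by (auto dest: finite_subset)
    then obtain A where "A \<in> \<M>" by blast
    then have "B \<in> \<M>" if "B \<in> kneser_vertices n k" for B
      using prefix_closedD[OF M(2) _ that] \<open>m = 0\<close> by simp
    moreover have "{1..k} \<in> kneser_vertices n k" "{k + 1..2 * k} \<in> kneser_vertices n k"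
      using n2k unfolding kneser_vertices_def by auto
    ultimately have "t \<le> card ({1..k} \<inter> {k + 1..2 * k})"
      using t_intersectingD[OF maximum_familyD(2)[OF M(1)]] by blast
    then show False using t(1) by simp
  qed
  moreover have min: "\<not> prefix_closed n k (m - 1) \<G>" if "maximum_family n k t \<G>" for \<G>
    using not_less_Least[of "m - 1" ?P] that \<open>m \<noteq> 0\<close> unfolding m_def[symmetric] by auto
  ultimately have "minimal_prefix_family n k t m \<M>"
    using M m(2) t n2k n(2) by (intro minimal_prefix_family.intro) simp_all
  then interpret minimal_prefix_family n k t m \<M> .
  show ?thesis using card_le card_le_star[OF n(1)] by simp
qed simp

section \<open>The treewidth\<close>

theorem mainTheorem6:
  fixes n k t :: nat
  assumes "0 < t" and "t < k"
    and "n \<ge> (t + 1) * (k + 1 - t)"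
    and "real n \<ge> real t + real (k + 1 - t) * real (k - t) / 2"
    and "real (n - t choose (k - t)) / 3 \<ge>
         (\<Sum>s = 1..min t (k - t). real ((t - 1 choose (s - 1)) * (k + 1 - t choose s)
              * (k - t + s choose s) * (n - t - s choose (k - t - s))))"
  shows "int (treewidth (kneser_vertices n k) (kneser_adj t))
         = int (n choose k) - int (n - t choose (k - t)) - 1"
proof -
  let ?V = "kneser_vertices n k" and ?E = "kneser_adj t"
  define N where "N = (n - t choose (k - t))"
  define b where "b s = (t - 1 choose (s - 1)) * (k + 1 - t choose s)
              * (k - t + s choose s) * (n - t - s choose (k - t - s))" for s
  have b_sum: "3 * (\<Sum>s = 1..min t (k - t). b s) \<le> N"
  proof -
    have "real (3 * (\<Sum>s = 1..min t (k - t). b s)) \<le> real N"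
      using assms(5) unfolding N_def b_def by simp
    then show ?thesis by (simp only: of_nat_le_iff)
  qed
  \<comment> \<open>The s = 1 term of (iii) is (d + 2)^2 (M choose d), while N is (M + 1)/(d + 1)
    times the same binomial. Hence n - t >= 3(d + 1)(d + 2)^2, and 12 is 3 * 2^2.\<close>
  have n_lower: "t + 12 * (k - t) \<le> n"
  proof -
    define d M where "d = k - t - 1" and "M = n - t - 1"
    have d: "k - t = Suc d" using assms(2) unfolding d_def by simp
    have "t + Suc d < n"
    proof -
      have "t + Suc d < (t + 1) * (Suc d + 1)" by simp
      then show ?thesis using assms(2,3) d by (simp add: Suc_diff_le)
    qed
    then have M: "n - t = Suc M" "Suc d \<le> M" unfolding M_def by auto
    have "b 1 \<le> (\<Sum>s = 1..min t (k - t). b s)"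
      using assms(1,2) by (intro member_le_sum) auto
    moreover have "b 1 = (d + 2) * (d + 2) * (M choose d)"
      using d assms(2) unfolding b_def M_def by (simp add: Suc_diff_le)
    ultimately have "3 * ((d + 2) * (d + 2) * (M choose d)) \<le> (Suc M choose Suc d)"
      using b_sum unfolding N_def d M by linarith
    then have "Suc d * (3 * ((d + 2) * (d + 2) * (M choose d))) \<le> Suc d * (Suc M choose Suc d)"
      by (rule mult_le_mono2)
    also have "\<dots> = Suc M * (M choose d)" by (rule Suc_times_binomial)
    finally have "(Suc d * (3 * ((d + 2) * (d + 2)))) * (M choose d) \<le> Suc M * (M choose d)"
      by (simp only: mult.assoc)
    then have "Suc d * (3 * ((d + 2) * (d + 2))) \<le> Suc M"
      using M(2) by (simp only: mult_le_cancel2) (simp add: zero_less_binomial_iff)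
    moreover have "Suc d * 12 \<le> Suc d * (3 * ((d + 2) * (d + 2)))"
      by (intro mult_le_mono2) simp
    ultimately have "Suc d * 12 \<le> Suc M" by (rule order_trans[rotated])
    then show ?thesis using M(1) d by simp
  qed
  have EKR: "card \<F> \<le> N" if "\<F> \<subseteq> ?V" "t_intersecting t \<F>" for \<F>
    unfolding N_def using n_lower assms(1,2)
    by (intro card_t_intersecting_le[OF assms(1,2,3) _ that]) linarith
  have cross: "t \<le> card (A1 \<inter> A2)"
    if A: "A1 \<in> ?V" "A2 \<in> ?V" and Q: "\<Q> \<subseteq> ?V" "real N / 3 < card \<Q>"
      "\<And>B. B \<in> \<Q> \<Longrightarrow> t \<le> card (B \<inter> A1) \<and> t \<le> card (B \<inter> A2)" for A1 A2 \<Q>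
  proof (rule ccontr)
    assume "\<not> t \<le> card (A1 \<inter> A2)"
    then have "card {B \<in> ?V. t \<le> card (B \<inter> A1) \<and> t \<le> card (B \<inter> A2)} \<le> (\<Sum>s = 1..min t (k - t). b s)"
      unfolding b_def using assms(1,2) by (intro card_common_nonneighbours_le A) auto
    moreover have "card \<Q> \<le> card {B \<in> ?V. t \<le> card (B \<inter> A1) \<and> t \<le> card (B \<inter> A2)}"
      using Q by (intro card_mono) auto
    ultimately have "3 * card \<Q> \<le> N" using b_sum by linarith
    then show False using Q(2) by linarith
  qed
  have width_ge: "(n choose k) - N - 1 \<le> td_width VT B" if td: "tree_decomposition ?V ?E VT ET B" for VT ET B
  proof (rule ccontr)
    assume "\<not> ?thesis"
    \<comment> \<open>Truncation is harmless here: a - 1 < b - 1 in the naturals still gives a <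
      b.\<close>
    then have less: "Max ((\<lambda>x. card (B x)) ` VT) < (n choose k) - N"
      unfolding td_width_def by linarith
    have finVT: "finite VT" and BV: "\<And>x. x \<in> VT \<Longrightarrow> B x \<subseteq> ?V"
      using td unfolding tree_decomposition_def is_tree_def by auto
    have small: "3 * (real N / 3) < card (?V - B x)" if x: "x \<in> VT" for x
    proof -
      have "card (B x) < (n choose k) - N"
        using finVT x by (intro le_less_trans[OF Max_ge less]) auto
      moreover have "card (?V - B x) = (n choose k) - card (B x)"
        using card_Diff_subset[OF finite_subset[OF BV[OF x]] BV[OF x]]
        by (simp add: card_kneser_vertices)
      ultimately show ?thesis by simp
    qed
    obtain P Q where PQ: "P \<subseteq> ?V" "Q \<subseteq> ?V" "P \<inter> Q = {}" "\<And>u v. u \<in> P \<Longrightarrow> v \<in> Q \<Longrightarrow> \<not> ?E u v"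
      "real N / 3 < card P" "real N / 3 < card Q" "3 * (real N / 3) < card P + card Q"
      using tree_decomposition_separation[OF finite_kneser_vertices td _ small] by auto
    have PQ_int: "t \<le> card (u \<inter> v)" if "u \<in> P" "v \<in> Q" for u v
      using PQ(4)[OF that] unfolding kneser_adj_def by simp
    then have QP_int: "t \<le> card (v \<inter> u)" if "u \<in> P" "v \<in> Q" for u v
      using that by (metis Int_commute)
    have "t \<le> card (u \<inter> v)" if "u \<in> P" "v \<in> P" for u v
      using that PQ QP_int by (intro cross[of u v Q]) auto
    moreover have "t \<le> card (u \<inter> v)" if "u \<in> Q" "v \<in> Q" for u v
      using that PQ PQ_int by (intro cross[of u v P]) auto
    ultimately have "t_intersecting t (P \<union> Q)"
      using PQ_int QP_int unfolding t_intersecting_def by blast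
    then have "card (P \<union> Q) \<le> N" using PQ(1,2) by (intro EKR) auto
    moreover have "card (P \<union> Q) = card P + card Q"
      using PQ(1-3) by (intro card_Un_disjoint) (auto intro: finite_subset)
    ultimately show False using PQ(7) by simp
  qed
  define I where "I = {F \<in> ?V. {1..t} \<subseteq> F}"
  have kn: "k < n" using n_lower assms(1,2) by linarith
  have card_I: "card I = N"
    using card_supersets[of "{1..n}" "{1..t}" k] kn assms(2)
    unfolding I_def N_def kneser_vertices_def by (simp add: conj_assoc)
  have "0 < N" using kn unfolding N_def by (simp add: zero_less_binomial_iff)
  then have I_ne: "I \<noteq> {}" using card_I by auto
  have card_diff: "card (?V - I) = (n choose k) - N"
    using card_Diff_subset[of I ?V] card_I unfolding I_def by (simp add: card_kneser_vertices)
  have degree: "card {u \<in> ?V. ?E v u} < card (?V - I)" if v: "v \<in> I" for v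
  proof -
    have v': "v \<subseteq> {1..n}" "card v = k" "finite v" "{1..t} \<subseteq> v"
      using v kneser_verticesD[of v n k] unfolding I_def by auto
    have "card v < card {1..n}" using v'(2) kn by simp
    then obtain x where x: "x \<in> {1..n}" "x \<notin> v" using v'(3) card_mono[OF v'(3), of "{1..n}"] by fastforce
    \<comment> \<open>A vertex outside the star that shares k - 1 >= t elements with
      \<open>v\<close>; this non-neighbour makes the degree bound strict.\<close>
    define u where "u = insert x (v - {1})"
    have "1 \<in> v" using v'(4) assms(1) by auto
    have u: "u \<in> ?V"
      unfolding u_def using v \<open>1 \<in> v\<close> x by (intro swap_in_kneser_vertices) (auto simp: I_def)
    have "v \<inter> u = v - {1}" using x unfolding u_def by blast
    then have nadj: "\<not> ?E v u" using v'(2) assms(2) \<open>1 \<in> v\<close> v'(3) unfolding kneser_adj_def by simp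
    have "1 \<notin> u" using x \<open>1 \<in> v\<close> unfolding u_def by auto
    moreover have "1 \<in> {1..t}" using assms(1) by simp
    ultimately have "u \<notin> I" unfolding I_def by blast
    moreover have "{w \<in> ?V. ?E v w} \<subseteq> ?V - I"
    proof -
      have "\<not> ?E v w" if "w \<in> I" for w
      proof -
        have "card {1..t} \<le> card (v \<inter> w)"
          using v'(3,4) that unfolding I_def by (intro card_mono) auto
        then show ?thesis unfolding kneser_adj_def by simp
      qed
      then show ?thesis by blast
    qed
    ultimately have "{w \<in> ?V. ?E v w} \<subset> ?V - I" using u nadj by blast
    then show ?thesis by (intro psubset_card_mono) auto
  qed
  have star: "\<exists>VT ET B. tree_decomposition ?V ?E VT ET B \<and> td_width VT B = (n choose k) - N - 1"
    unfolding card_diff[symmetric]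
  proof (rule star_tree_decomposition)
    have "t \<le> card (u \<inter> v)" if "u \<in> I" "v \<in> I" for u v
    proof -
      have "card {1..t} \<le> card (u \<inter> v)"
        using that kneser_verticesD(3) unfolding I_def by (intro card_mono) auto
      then show ?thesis by simp
    qed
    then show "\<not> ?E u v" if "u \<in> I" "v \<in> I" for u v
      using that unfolding kneser_adj_def by (simp add: not_less)
    show "I \<noteq> {}" by (rule I_ne)
  qed (use degree in \<open>auto simp: I_def kneser_adj_def Int_commute\<close>)
  have "treewidth ?V ?E = (n choose k) - N - 1"
    unfolding treewidth_def using star width_ge by (intro Least_equality) blast+
  \<comment> \<open>Makes the truncated subtraction in the width agree with the integer one.\<close>
  moreover have "N < (n choose k)"
  proof -
    obtain v where v: "v \<in> I" using I_ne by blast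
    then show ?thesis using degree[OF v] unfolding card_diff by linarith
  qed
  ultimately show ?thesis unfolding N_def[symmetric] by simp
qed

end
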